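(* Let $\mathcal X$ be an RD-space, let $\rho$ be an admissible function on $\mathcal X$, let $\epsilon_1\in(0,1]$, $\epsilon_2\in(0,\infty)$, let $\{S_t\}_{t>0}$ be a continuous approximation of the identity of order $(\epsilon_1,\epsilon_2)$, and let $S^+(f)(x)=\sup_{t>0}|S_t(f)(x)|$ for $x\in\mathcal X$. Then there exists a positive constant $C$ such that for all $f\in\mathrm{BMO}_\rho(\mathcal X)$, $$\|S^+(f)\|_{\mathrm{BLO}_\rho(\mathcal X)}\le C\|f\|_{\mathrm{BMO}_\rho(\mathcal X)}.$$
   Context: RD-space: $(\mathcal X,d)$ is a metric space with a regular Borel measure $\mu$ such that all balls $B(x,r)=\{y: d(x,y)<r\}$ have finite and positive measure; $\mu$ is doubling, i.e. there is $A_1\ge1$ with $\mu(B(x,2r))\le A_1\mu(B(x,r))$ for all $x\in\mathcal X$, $r>0$; and there are $0<\kappa\le n$, $A_2\in(0,1]$, $A_3\in[1,\infty)$ such that $A_2\lambda^\kappa\mu(B(x,r))\le\mu(B(x,\lambda r))\le A_3\lambda^n\mu(B(x,r))$ for all $x\in\mathcal X$, $0<r\le \mathrm{diam}(\mathcal X)/2$ and $1\le\lambda\le \mathrm{diam}(\mathcal X)/(2r)$. Balls are understood together with their center and radius. Write $V_r(x)=\mu(B(x,r))$ and $V(x,y)=\mu(B(x,d(x,y)))$. Admissible function: $\rho:\mathcal X\to(0,\infty)$ is admissible if there are positive constants $C_0,k_0$ such that $\frac1{\rho(x)}\le C_0\frac1{\rho(y)}\left(1+\frac{d(x,y)}{\rho(y)}\right)^{k_0}$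 for all $x,y\in\mathcal X$. Continuous approximation of the identity of order $(\epsilon_1,\epsilon_2)$: a family $\{S_t\}_{t>0}$ of bounded linear integral operators on $L^2(\mathcal X)$ with measurable kernels $S_t(x,y):\mathcal X\times\mathcal X\to\mathbb C$ (so $S_t(f)(x)=\int_{\mathcal X}S_t(x,y)f(y)\,d\mu(y)$) for which there is a positive constant $A_4$ such that for all $t>0$ and $x,x',y\in\mathcal X$: (i) $|S_t(x,y)|\le A_4\frac1{V_t(x)+V_t(y)+V(x,y)}\frac{t^{\epsilon_2}}{(t+d(x,y))^{\epsilon_2}}$; (ii) $|S_t(x,y)-S_t(x',y)|\le A_4\left(\frac{d(x,x')}{t+d(x,y)}\right)^{\epsilon_1}\frac1{V_t(x)+V_t(y)+V(x,y)}\frac{t^{\epsilon_2}}{(t+d(x,y))^{\epsilon_2}}$ whenever $d(x,x')\le(t+d(x,y))/2$; (iii) property (ii) also holds with the roles of $x$ and $y$ interchanged; (iv) $\int_{\mathcal X}S_t(x,z)\,d\mu(z)=1=\int_{\mathcal X}S_t(z,y)\,d\mu(z)$. $L^1_{\rm loc}(\mathcal X)$ means integrable on every ball; $f_B=\frac1{\mu(B)}\int_B f\,d\mu$. With $\mathcal D$ the collection of balls $B(x,r)$ with $r\ge\rho(x)$, $\mathrm{BMO}_\rho(\mathcal X)$ and $\mathrm{BLO}_\rho(\mathcal X)$ (the latter consisting of real-valued functions) are the sets of $f\in L^1_{\rm loc}(\mathcal X)$ for which, respectively, the following are finite: $$\|f\|_{\mathrm{BMO}_\rho(\mathcal X)}=\sup_{B\notin\mathcal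 D}\frac1{\mu(B)}\int_B|f-f_B|\,d\mu+\sup_{B\in\mathcal D}\frac1{\mu(B)}\int_B|f|\,d\mu,$$ $$\|f\|_{\mathrm{BLO}_\rho(\mathcal X)}=\sup_{B\notin\mathcal D}\frac1{\mu(B)}\int_B\left[f-\operatorname*{ess\,inf}_B f\right]d\mu+\sup_{B\in\mathcal D}\frac1{\mu(B)}\int_B|f|\,d\mu.$$ *)

theory Defs
  imports "HOL-Probability.Essential_Supremum"
begin

text \<open>The metric space is the whole type. The extended diameter is needed because
  \<^const>\<open>diameter\<close> is unspecified on unbounded sets.\<close>

definition ediam :: "'a::metric_space itself \<Rightarrow> ereal" where
  "ediam _ = (SUP x::'a. SUP y::'a. ereal (dist x y))"

text \<open>A measure on a \<open>\<sigma>\<close>-algebra containing the Borel sets, for instance a measure on the Borel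
  sets or its completion. Regularity is outer regularity by open sets; no inner regularity by
  compact sets is asked for.\<close>

definition regular_borel_measure :: "'a::metric_space measure \<Rightarrow> bool" where
  "regular_borel_measure \<mu> \<longleftrightarrow>
     sets borel \<subseteq> sets \<mu> \<and>
     (\<forall>A\<in>sets \<mu>. emeasure \<mu> A = (INF U\<in>{U. open U \<and> A \<subseteq> U}. emeasure \<mu> U))"

definition doubling :: "'a::metric_space measure \<Rightarrow> bool" where
  "doubling \<mu> \<longleftrightarrow>
     (\<exists>A\<^sub>1\<ge>1. \<forall>x r. r > 0 \<longrightarrow> measure \<mu> (ball x (2 * r)) \<le> A\<^sub>1 * measure \<mu> (ball x r))"

definition RD_space :: "'a::metric_space measure \<Rightarrow> bool" where
  "RD_space \<mu> \<longleftrightarrow>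
     regular_borel_measure \<mu> \<and>
     (\<forall>x r. r > 0 \<longrightarrow> 0 < emeasure \<mu> (ball x r) \<and> emeasure \<mu> (ball x r) < \<infinity>) \<and>
     doubling \<mu> \<and>
     (\<exists>\<kappa> n A\<^sub>2 A\<^sub>3 :: real. 0 < \<kappa> \<and> \<kappa> \<le> n \<and> 0 < A\<^sub>2 \<and> A\<^sub>2 \<le> 1 \<and> 1 \<le> A\<^sub>3 \<and>
        (\<forall>x r l. 0 < r \<and> ereal r \<le> ediam TYPE('a) / 2 \<and>
                 1 \<le> l \<and> ereal l \<le> ediam TYPE('a) / ereal (2 * r) \<longrightarrow>
           A\<^sub>2 * l powr \<kappa> * measure \<mu> (ball x r) \<le> measure \<mu> (ball x (l * r)) \<and>
           measure \<mu> (ball x (l * r)) \<le> A\<^sub>3 * l powr n * measure \<mu> (ball x r)))"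

definition admissible :: "('a::metric_space \<Rightarrow> real) \<Rightarrow> bool" where
  "admissible \<rho> \<longleftrightarrow>
     (\<forall>x. \<rho> x > 0) \<and>
     (\<exists>C\<^sub>0>0. \<exists>k\<^sub>0>0. \<forall>x y. 1 / \<rho> x \<le> C\<^sub>0 * (1 / \<rho> y) * (1 + dist x y / \<rho> y) powr k\<^sub>0)"

definition integral_operator ::
  "'a measure \<Rightarrow> ('a \<Rightarrow> 'a \<Rightarrow> complex) \<Rightarrow> ('a \<Rightarrow> complex) \<Rightarrow> 'a \<Rightarrow> complex" where
  "integral_operator \<mu> K f x = (\<integral>y. K x y * f y \<partial>\<mu>)"

definition L2_bounded :: "'a measure \<Rightarrow> ('a \<Rightarrow> 'a \<Rightarrow> complex) \<Rightarrow> bool" where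
  "L2_bounded \<mu> K \<longleftrightarrow>
     (\<exists>M::real. M \<ge> 0 \<and>
       (\<forall>f\<in>borel_measurable \<mu>. (\<integral>\<^sup>+y. ennreal ((cmod (f y))\<^sup>2) \<partial>\<mu>) < \<infinity> \<longrightarrow>
          (AE x in \<mu>. integrable \<mu> (\<lambda>y. K x y * f y)) \<and>
          integral_operator \<mu> K f \<in> borel_measurable \<mu> \<and>
          (\<integral>\<^sup>+x. ennreal ((cmod (integral_operator \<mu> K f x))\<^sup>2) \<partial>\<mu>)
            \<le> ennreal (M\<^sup>2) * (\<integral>\<^sup>+y. ennreal ((cmod (f y))\<^sup>2) \<partial>\<mu>)))"

definition size_bound :: "'a::metric_space measure \<Rightarrow> real \<Rightarrow> real \<Rightarrow> 'a \<Rightarrow> 'a \<Rightarrow> real" where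
  "size_bound \<mu> \<epsilon>\<^sub>2 t x y =
     1 / (measure \<mu> (ball x t) + measure \<mu> (ball y t) + measure \<mu> (ball x (dist x y))) *
     (t powr \<epsilon>\<^sub>2 / (t + dist x y) powr \<epsilon>\<^sub>2)"

text \<open>Only the values \<open>S t\<close> with \<open>t > 0\<close> matter.\<close>

definition continuous_approximation_of_identity ::
  "'a::metric_space measure \<Rightarrow> real \<Rightarrow> real \<Rightarrow> (real \<Rightarrow> 'a \<Rightarrow> 'a \<Rightarrow> complex) \<Rightarrow> bool" where
  "continuous_approximation_of_identity \<mu> \<epsilon>\<^sub>1 \<epsilon>\<^sub>2 S \<longleftrightarrow>
     (\<forall>t>0. (\<lambda>(x, y). S t x y) \<in> borel_measurable (\<mu> \<Otimes>\<^sub>M \<mu>) \<and> L2_bounded \<mu> (S t)) \<and>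
     (\<exists>A\<^sub>4>0. \<forall>t>0.
        (\<forall>x y. cmod (S t x y) \<le> A\<^sub>4 * size_bound \<mu> \<epsilon>\<^sub>2 t x y) \<and>
        (\<forall>x x' y. dist x x' \<le> (t + dist x y) / 2 \<longrightarrow>
           cmod (S t x y - S t x' y)
             \<le> A\<^sub>4 * (dist x x' / (t + dist x y)) powr \<epsilon>\<^sub>1 * size_bound \<mu> \<epsilon>\<^sub>2 t x y) \<and>
        (\<forall>x y y'. dist y y' \<le> (t + dist x y) / 2 \<longrightarrow>
           cmod (S t x y - S t x y')
             \<le> A\<^sub>4 * (dist y y' / (t + dist x y)) powr \<epsilon>\<^sub>1 * size_bound \<mu> \<epsilon>\<^sub>2 t x y)) \<and>
     (\<forall>t>0. \<forall>x. integrable \<mu> (\<lambda>z. S t x z) \<and> (\<integral>z. S t x z \<partial>\<mu>) = 1) \<and>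
     (\<forall>t>0. \<forall>y. integrable \<mu> (\<lambda>z. S t z y) \<and> (\<integral>z. S t z y \<partial>\<mu>) = 1)"

definition radial_maximal ::
  "'a measure \<Rightarrow> (real \<Rightarrow> 'a \<Rightarrow> 'a \<Rightarrow> complex) \<Rightarrow> ('a \<Rightarrow> complex) \<Rightarrow> 'a \<Rightarrow> ennreal" where
  "radial_maximal \<mu> S f x = (SUP t\<in>{0<..}. ennreal (cmod (integral_operator \<mu> (S t) f x)))"

definition L1_loc :: "'a::metric_space measure \<Rightarrow> ('a \<Rightarrow> 'b::{banach, second_countable_topology}) set" where
  "L1_loc \<mu> = {f. \<forall>x r. r > 0 \<longrightarrow> set_integrable \<mu> (ball x r) f}"

definition ball_mean ::
  "'a::metric_space measure \<Rightarrow> 'a \<Rightarrow> real \<Rightarrow> ('a \<Rightarrow> 'b::{banach, second_countable_topology}) \<Rightarrow> 'b" where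
  "ball_mean \<mu> x r f = set_lebesgue_integral \<mu> (ball x r) f /\<^sub>R measure \<mu> (ball x r)"

text \<open>The mean over a ball of a nonnegative, possibly infinite function.\<close>

definition ball_mean_nn :: "'a::metric_space measure \<Rightarrow> 'a \<Rightarrow> real \<Rightarrow> ('a \<Rightarrow> ennreal) \<Rightarrow> ennreal" where
  "ball_mean_nn \<mu> x r g = (\<integral>\<^sup>+y\<in>ball x r. g y \<partial>\<mu>) / emeasure \<mu> (ball x r)"

definition ess_inf_ball :: "'a::metric_space measure \<Rightarrow> 'a \<Rightarrow> real \<Rightarrow> ('a \<Rightarrow> real) \<Rightarrow> ereal" where
  "ess_inf_ball \<mu> x r f = - esssup (restrict_space \<mu> (ball x r)) (\<lambda>y. - ereal (f y))"

text \<open>Balls are represented by their center and radius.\<close>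

definition large_balls :: "('a \<Rightarrow> real) \<Rightarrow> ('a \<times> real) set" where
  "large_balls \<rho> = {(x, r). 0 < r \<and> \<rho> x \<le> r}"

definition small_balls :: "('a \<Rightarrow> real) \<Rightarrow> ('a \<times> real) set" where
  "small_balls \<rho> = {(x, r). 0 < r} - large_balls \<rho>"

definition BMO_norm :: "'a::metric_space measure \<Rightarrow> ('a \<Rightarrow> real) \<Rightarrow> ('a \<Rightarrow> complex) \<Rightarrow> ennreal" where
  "BMO_norm \<mu> \<rho> f =
     (SUP (x, r)\<in>small_balls \<rho>. ball_mean_nn \<mu> x r (\<lambda>y. ennreal (cmod (f y - ball_mean \<mu> x r f)))) +
     (SUP (x, r)\<in>large_balls \<rho>. ball_mean_nn \<mu> x r (\<lambda>y. ennreal (cmod (f y))))"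

definition BMO :: "'a::metric_space measure \<Rightarrow> ('a \<Rightarrow> real) \<Rightarrow> ('a \<Rightarrow> complex) set" where
  "BMO \<mu> \<rho> = {f \<in> L1_loc \<mu>. BMO_norm \<mu> \<rho> f < \<infinity>}"

text \<open>The essential infimum may be \<open>-\<infinity>\<close>; then the mean, and hence the norm, is infinite.\<close>

definition BLO_norm :: "'a::metric_space measure \<Rightarrow> ('a \<Rightarrow> real) \<Rightarrow> ('a \<Rightarrow> real) \<Rightarrow> ennreal" where
  "BLO_norm \<mu> \<rho> f =
     (SUP (x, r)\<in>small_balls \<rho>.
        ball_mean_nn \<mu> x r (\<lambda>y. e2ennreal (ereal (f y) - ess_inf_ball \<mu> x r f))) +
     (SUP (x, r)\<in>large_balls \<rho>. ball_mean_nn \<mu> x r (\<lambda>y. ennreal \<bar>f y\<bar>))"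

definition BLO :: "'a::metric_space measure \<Rightarrow> ('a \<Rightarrow> real) \<Rightarrow> ('a \<Rightarrow> real) set" where
  "BLO \<mu> \<rho> = {f \<in> L1_loc \<mu>. BLO_norm \<mu> \<rho> f < \<infinity>}"

end

theory Submission
  imports Defs
begin

text \<open>
  Write \<open>a(x,r)\<close> for the mean of \<open>f\<close> over \<open>B(x,r)\<close>, \<open>u(x,t) = S\<^sub>t f(x)\<close>, \<open>N\<close> for the BMO norm
  of \<open>f\<close>, and \<open>C\<close> for constants that depend only on the space and the kernels. The mean
  oscillation of \<open>f\<close> over every ball is at most \<open>2N\<close>, so by doubling the means over two comparable
  nearby balls differ by at most \<open>C N\<close>. The kernel \<open>S\<^sub>t(x,y)\<close> has integral one in \<open>y\<close> and is dominated by a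
  geometric average of normalised indicators of \<open>B(x,2\<^sup>jt)\<close>
  (\<open>size_bound_le_majorant\<close>), which gives \<open>|u(x,t) - a(x,t)| \<le> C N\<close>
  (\<open>kernel_integral_near_mean\<close>). Hence \<open>u\<close> inherits the stability of the means, and, by the
  Hoelder condition, it is continuous in \<open>x\<close>, so that all suprema are measurable.

  Given a ball \<open>B(x\<^sub>0,r)\<close>, the scales \<open>t \<ge> r\<close> are harmless: there \<open>u(x,t)\<close> and \<open>u(y,t)\<close> differ by
  at most \<open>C N\<close> for all \<open>x, y\<close> in the ball, and if \<open>r \<ge> \<rho>(x\<^sub>0)\<close>, then \<open>|u(x,t)| \<le> C N\<close>
  because \<open>B(x\<^sub>0,t)\<close> is again a large ball. The scales \<open>t < r\<close> are controlled by
  \<open>H(x) = sup\<^sub>k |u(x, 2\<^sup>-\<^sup>k r) - u(x, r)|\<close>. Therefore \<open>S\<^sup>+f(x) \<le> S\<^sup>+f(y) + C N + H(x)\<close> for all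
  \<open>x, y\<close> in any ball, and \<open>S\<^sup>+f(x) \<le> C N + H(x)\<close> on large balls. Both parts of the BLO estimate
  follow once the mean of \<open>H\<close> over \<open>B(x\<^sub>0,r)\<close> is at most \<open>C N\<close>.

  That last bound (\<open>dyadic_max_integral_le\<close>) is a form of the boundedness of the maximal function on
  BMO, and it is proved by a self-improvement: restrict \<open>H\<close> to the
  first \<open>n\<close> scales, stop at the first scale at which the oscillation exceeds a suitable multiple of
  \<open>N\<close>, and cover the stopped points by balls of total measure at most half of that of \<open>B(x\<^sub>0,r)\<close>.
  On each of these balls \<open>H\<close> is at most \<open>C N\<close> plus the same quantity for that ball, so any bound \<open>M\<close>
  that is valid on all balls improves to \<open>C N + M/2\<close> (\<open>stopping_time_improvement\<close>).
  Iteration removes the crude initial bound, and with it the dependence on \<open>n\<close>.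
\<close>

section \<open>A finite Vitali selection\<close>

text \<open>Greedy selection: take an element of maximal size, discard everything that meets it, and
  repeat. Each step lowers the bound on the cardinality of disjoint subfamilies, which is therefore
  the induction variable; finiteness of the set of sizes makes the maximum exist.\<close>

lemma vitali_finite_selection:
  fixes B :: "'i \<Rightarrow> 'a set" and r :: "'i \<Rightarrow> real"
  assumes "finite (r ` E)" and "\<And>x. x \<in> E \<Longrightarrow> B x \<noteq> {}"
    and "\<And>F. finite F \<Longrightarrow> F \<subseteq> E \<Longrightarrow> disjoint_family_on B F \<Longrightarrow> card F \<le> n"
  shows "\<exists>A. finite A \<and> A \<subseteq> E \<and> disjoint_family_on B A \<and>
           (\<forall>x\<in>E. \<exists>z\<in>A. r x \<le> r z \<and> B x \<inter> B z \<noteq> {})"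
  using assms
proof (induction n arbitrary: E)
  case 0
  have "E = {}"
  proof (rule ccontr)
    assume "E \<noteq> {}"
    then obtain x where "x \<in> E" by blast
    with 0(3)[of "{x}"] show False by (auto simp: disjoint_family_on_def)
  qed
  then show ?case by (auto simp: disjoint_family_on_def)
next
  case (Suc n)
  show ?case
  proof (cases "E = {}")
    case True
    then show ?thesis by (auto simp: disjoint_family_on_def)
  next
    case False
    have "Max (r ` E) \<in> r ` E" using Suc.prems(1) False by (intro Max_in) auto
    then obtain z where z: "z \<in> E" "r z = Max (r ` E)" by auto
    have zmax: "r x \<le> r z" if "x \<in> E" for x
      using that z Suc.prems(1) by simp
    define E' where "E' = {x \<in> E. B x \<inter> B z = {}}"
    have zE': "z \<notin> E'" using Suc.prems(2)[OF z(1)] by (auto simp: E'_def)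
    have "\<exists>A. finite A \<and> A \<subseteq> E' \<and> disjoint_family_on B A \<and>
           (\<forall>x\<in>E'. \<exists>z\<in>A. r x \<le> r z \<and> B x \<inter> B z \<noteq> {})"
    proof (rule Suc.IH)
      show "finite (r ` E')"
        by (rule finite_subset[OF _ Suc.prems(1)]) (auto simp: E'_def)
      show "B x \<noteq> {}" if "x \<in> E'" for x using that Suc.prems(2) by (auto simp: E'_def)
      fix F assume F: "finite F" "F \<subseteq> E'" "disjoint_family_on B F"
      have "card (insert z F) \<le> Suc n"
        using F z(1) by (intro Suc.prems(3)) (auto simp: disjoint_family_on_def E'_def)
      then show "card F \<le> n" using F zE' by (subst (asm) card_insert_disjoint) auto
    qed
    then obtain A where A: "finite A" "A \<subseteq> E'" "disjoint_family_on B A"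
        "\<forall>x\<in>E'. \<exists>z\<in>A. r x \<le> r z \<and> B x \<inter> B z \<noteq> {}" by blast
    show ?thesis
    proof (intro exI[of _ "insert z A"] conjI ballI)
      show "finite (insert z A)" "insert z A \<subseteq> E" using A z by (auto simp: E'_def)
      show "disjoint_family_on B (insert z A)"
        using A by (auto simp: disjoint_family_on_def E'_def)
      fix x assume x: "x \<in> E"
      show "\<exists>w\<in>insert z A. r x \<le> r w \<and> B x \<inter> B w \<noteq> {}"
      proof (cases "x \<in> E'")
        case True then show ?thesis using A by blast
      next
        case False then show ?thesis using x zmax by (auto simp: E'_def)
      qed
    qed
  qed
qed

section \<open>Balls, means and majorants in a doubling space\<close>

locale doubling_balls =
  fixes \<mu> :: "'a::metric_space measure" and D :: real
  assumes borel_sub: "sets borel \<subseteq> sets \<mu>"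
    and ball_pos: "0 < r \<Longrightarrow> 0 < emeasure \<mu> (ball x r)"
    and ball_fin: "0 < r \<Longrightarrow> emeasure \<mu> (ball x r) < \<infinity>"
    and D_ge_1: "1 \<le> D"
    and doubling_step: "0 < r \<Longrightarrow> measure \<mu> (ball x (2 * r)) \<le> D * measure \<mu> (ball x r)"
begin

abbreviation V :: "'a \<Rightarrow> real \<Rightarrow> real" where
  "V x r \<equiv> measure \<mu> (ball x r)"

lemma space_eq [simp]: "space \<mu> = UNIV"
proof -
  have "UNIV \<in> sets \<mu>" using borel_sub by (metis sets.top space_borel subsetD)
  then show ?thesis using sets.sets_into_space by blast
qed

lemma ball_sets [measurable]: "ball x r \<in> sets \<mu>"
  using borel_sub by auto

lemma borel_measurable_transfer: "g \<in> borel_measurable borel \<Longrightarrow> g \<in> borel_measurable \<mu>"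
  using borel_sub by (auto simp: measurable_def)

lemma emeasure_ball_eq: "0 < r \<Longrightarrow> emeasure \<mu> (ball x r) = ennreal (V x r)"
  using ball_fin[of r x] by (intro emeasure_eq_ennreal_measure) auto

lemma V_pos: "0 < r \<Longrightarrow> 0 < V x r"
  using ball_pos[of r x] by (simp add: emeasure_ball_eq)

lemma V_mono: "ball x r \<subseteq> ball y s \<Longrightarrow> 0 < s \<Longrightarrow> V x r \<le> V y s"
  using ball_fin[of s y] by (intro measure_mono_fmeasurable) (auto simp: fmeasurable_def)

lemma V_iterate: "0 < r \<Longrightarrow> V x (2 ^ m * r) \<le> D ^ m * V x r"
proof (induction m)
  case (Suc m)
  have "V x (2 * (2 ^ m * r)) \<le> D * V x (2 ^ m * r)"
    using Suc.prems by (intro doubling_step) simp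
  also have "\<dots> \<le> D * (D ^ m * V x r)"
    using Suc D_ge_1 by (intro mult_left_mono) auto
  finally show ?case by (simp add: mult.assoc)
qed simp

text \<open>The hypothesis says that \<open>B(y,s)\<close> lies in the \<open>m\<close>-fold doubling of \<open>B(x,r)\<close>.\<close>

lemma V_compare:
  assumes "0 < r" "s + dist x y \<le> 2 ^ m * r"
  shows "V y s \<le> D ^ m * V x r"
proof -
  have "V y s \<le> V x (2 ^ m * r)"
  proof (rule V_mono)
    show "ball y s \<subseteq> ball x (2 ^ m * r)"
    proof
      fix w assume "w \<in> ball y s"
      then show "w \<in> ball x (2 ^ m * r)" using assms dist_triangle[of x w y] by simp
    qed
  qed (use assms in simp)
  also have "\<dots> \<le> D ^ m * V x r" by (rule V_iterate) fact
  finally show ?thesis .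
qed

lemma nn_integral_const_ball:
  "0 < r \<Longrightarrow> 0 \<le> c \<Longrightarrow> (\<integral>\<^sup>+y\<in>ball x r. ennreal c \<partial>\<mu>) = ennreal (c * V x r)"
  by (simp add: nn_integral_cmult_indicator emeasure_ball_eq ennreal_mult)

lemma ball_mean_nn_le_iff:
  assumes "0 < r" "0 \<le> c"
  shows "ball_mean_nn \<mu> x r g \<le> ennreal c \<longleftrightarrow> (\<integral>\<^sup>+y\<in>ball x r. g y \<partial>\<mu>) \<le> ennreal (c * V x r)"
proof -
  have "ennreal c * emeasure \<mu> (ball x r) = ennreal (c * V x r)"
    using assms by (simp add: emeasure_ball_eq ennreal_mult)
  moreover have "a / b \<le> ennreal c \<longleftrightarrow> a \<le> ennreal c * b" if "0 < b" "b < \<infinity>" for a b :: ennreal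
    using that by (cases a; cases b)
      (auto simp: divide_ennreal ennreal_mult[symmetric] field_simps ennreal_top_divide ennreal_top_mult assms(2) top_unique)
  ultimately show ?thesis
    using assms ball_pos[of r x] ball_fin[of r x] by (simp add: ball_mean_nn_def)
qed


lemma L1_loc_measurable:
  fixes g :: "'a \<Rightarrow> 'b::{banach, second_countable_topology}"
  assumes "g \<in> L1_loc \<mu>"
  shows "g \<in> borel_measurable \<mu>"
proof (rule borel_measurable_LIMSEQ_metric)
  fix n :: nat
  have "set_integrable \<mu> (ball undefined (real (Suc n))) g"
    using assms unfolding L1_loc_def by (auto simp del: of_nat_Suc)
  then show "(\<lambda>y. indicator (ball undefined (real (Suc n))) y *\<^sub>R g y) \<in> borel_measurable \<mu>"
    unfolding set_integrable_def by (rule borel_measurable_integrable)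
next
  fix y :: 'a
  obtain m :: nat where m: "dist undefined y < real m" using reals_Archimedean2 by blast
  have "eventually (\<lambda>n. indicator (ball undefined (real (Suc n))) y *\<^sub>R g y = g y) sequentially"
    using eventually_ge_at_top[of m] by eventually_elim (use m in auto)
  then show "(\<lambda>n. indicator (ball undefined (real (Suc n))) y *\<^sub>R g y) \<longlonglongrightarrow> g y"
    by (rule tendsto_eventually)
qed

lemma mean_deviation:
  fixes f :: "'a \<Rightarrow> complex"
  assumes r: "0 < r" and f: "f \<in> L1_loc \<mu>" and "0 \<le> I"
    and le: "(\<integral>\<^sup>+y\<in>ball x r. ennreal (cmod (f y - c)) \<partial>\<mu>) \<le> ennreal I"
  shows "cmod (ball_mean \<mu> x r f - c) * V x r \<le> I"
proof -
  let ?B = "ball x r"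
  have fi: "set_integrable \<mu> ?B f" using f r by (auto simp: L1_loc_def)
  have ci: "set_integrable \<mu> ?B (\<lambda>_. c)"
    unfolding set_integrable_def using ball_fin[OF r, of x]
    by (intro integrable_scaleR_left integrable_real_indicator) auto
  have i: "set_integrable \<mu> ?B (\<lambda>y. f y - c)" using fi ci by (rule set_integral_diff(1))
  have "set_lebesgue_integral \<mu> ?B (\<lambda>y. f y - c) = set_lebesgue_integral \<mu> ?B f - V x r *\<^sub>R c"
    unfolding set_integral_diff(2)[OF fi ci] set_lebesgue_integral_def[of _ _ "\<lambda>_. c"]
    using ball_fin[OF r, of x] by (subst integral_scaleR_left) auto
  also have "\<dots> = V x r *\<^sub>R (ball_mean \<mu> x r f - c)"
    using V_pos[OF r, of x] by (simp add: ball_mean_def algebra_simps)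
  finally have eq: "set_lebesgue_integral \<mu> ?B (\<lambda>y. f y - c) = V x r *\<^sub>R (ball_mean \<mu> x r f - c)" .
  have "ennreal (cmod (set_lebesgue_integral \<mu> ?B (\<lambda>y. f y - c)))
        \<le> (\<integral>\<^sup>+y. ennreal (cmod (indicator ?B y *\<^sub>R (f y - c))) \<partial>\<mu>)"
    using i unfolding set_integrable_def set_lebesgue_integral_def by (rule integral_norm_bound_ennreal)
  also have "\<dots> = (\<integral>\<^sup>+y\<in>?B. ennreal (cmod (f y - c)) \<partial>\<mu>)"
    by (intro nn_integral_cong) (auto simp: indicator_def)
  also note le
  finally show ?thesis using \<open>0 \<le> I\<close> by (simp add: eq mult.commute)
qed

lemma recentre:
  fixes f :: "'a \<Rightarrow> complex"
  assumes [measurable]: "f \<in> borel_measurable \<mu>" and "0 < r" "0 \<le> m" "0 \<le> c" "cmod (w - z) \<le> c"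
    and le: "(\<integral>\<^sup>+y\<in>ball x r. ennreal (cmod (f y - w)) \<partial>\<mu>) \<le> ennreal (m * V x r)"
  shows "(\<integral>\<^sup>+y\<in>ball x r. ennreal (cmod (f y - z)) \<partial>\<mu>) \<le> ennreal ((m + c) * V x r)"
proof -
  have "(\<integral>\<^sup>+y\<in>ball x r. ennreal (cmod (f y - z)) \<partial>\<mu>)
        \<le> (\<integral>\<^sup>+y. (ennreal (cmod (f y - w)) * indicator (ball x r) y
              + ennreal c * indicator (ball x r) y) \<partial>\<mu>)"
  proof (rule nn_integral_mono)
    fix y
    have "cmod (f y - z) \<le> cmod (f y - w) + c"
      using norm_triangle_ineq[of "f y - w" "w - z"] assms(5) by simp
    then have "ennreal (cmod (f y - z)) \<le> ennreal (cmod (f y - w)) + ennreal c"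
      using assms(4) by (simp flip: ennreal_plus)
    then show "ennreal (cmod (f y - z)) * indicator (ball x r) y
        \<le> ennreal (cmod (f y - w)) * indicator (ball x r) y + ennreal c * indicator (ball x r) y"
      by (auto simp: indicator_def)
  qed
  also have "\<dots> = (\<integral>\<^sup>+y\<in>ball x r. ennreal (cmod (f y - w)) \<partial>\<mu>)
                 + (\<integral>\<^sup>+y\<in>ball x r. ennreal c \<partial>\<mu>)"
    by (rule nn_integral_add) measurable
  also have "\<dots> \<le> ennreal (m * V x r) + ennreal (c * V x r)"
    by (intro add_mono le) (simp add: nn_integral_const_ball assms)
  also have "\<dots> = ennreal ((m + c) * V x r)"
    using assms by (simp add: algebra_simps flip: ennreal_plus)
  finally show ?thesis .
qed

text \<open>A superposition of normalised indicators of the balls \<open>B(x,2\<^sup>jt)\<close> with geometric weights. Unlike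
  \<^const>\<open>size_bound\<close> it is visibly measurable in \<open>y\<close>, and integrating against it only requires
  averages over balls.\<close>

definition dyadic_majorant :: "real \<Rightarrow> real \<Rightarrow> 'a \<Rightarrow> 'a \<Rightarrow> ennreal" where
  "dyadic_majorant q t x y =
     (\<Sum>j. ennreal (q ^ j / V x (2 ^ j * t)) * indicator (ball x (2 ^ j * t)) y)"

text \<open>The factor, depending only on the doubling constant, in the maximal oscillation estimate
  \<open>dyadic_max_integral_le\<close>.\<close>

definition osc_const :: real where
  "osc_const = 2 * (4 + 2 * D^2)"

text \<open>The mean of \<open>f\<close> over \<open>B(x,2\<^sup>jt)\<close> drifts away from the one over \<open>B(x,t)\<close> by at most \<open>j D\<close> times the
  oscillation bound; the weights of the majorant sum this drift together with the oscillation.\<close>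

definition tail_sum :: "real \<Rightarrow> real" where
  "tail_sum q = (\<Sum>j. q ^ j * (1 + real j * D))"

lemma tail_sum_summable:
  assumes "0 < q" "q < 1"
  shows "summable (\<lambda>j. q ^ j * (1 + real j * D))"
proof -
  have "summable (\<lambda>j. q * (real (Suc j) * q ^ j))"
    using geometric_deriv_sums[of q] assms by (intro summable_mult) (auto simp: sums_iff)
  then have "summable (\<lambda>j. real (Suc j) * q ^ Suc j)" by (simp add: mult_ac)
  then have "summable (\<lambda>j. real j * q ^ j)" by (subst (asm) summable_Suc_iff)
  then have "summable (\<lambda>j. q ^ j + D * (real j * q ^ j))"
    using assms by (intro summable_add summable_mult summable_geometric) auto
  then show ?thesis by (simp add: algebra_simps)
qed

text \<open>On the annulus \<open>2\<^sup>i t \<le> d(x,y) < 2\<^sup>i\<^sup>+\<^sup>1 t\<close> the decay factor is at most \<open>q\<^sup>i\<close> and \<open>V(x,y)\<close> is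
  comparable with the measure of \<open>B(x,2\<^sup>i\<^sup>+\<^sup>1 t)\<close>, so one single term of the majorant suffices.\<close>

lemma size_bound_le_majorant:
  assumes t: "0 < t" and e: "0 < \<epsilon>" and q: "q = 2 powr - \<epsilon>"
  shows "ennreal (size_bound \<mu> \<epsilon> t x y) \<le> ennreal (D / q) * dyadic_majorant q t x y"
proof -
  let ?d = "dist x y"
  have q01: "0 < q" "q \<le> 1" using e by (auto simp: q powr_minus_divide ge_one_powr_ge_zero)
  obtain j where j: "?d < 2 ^ j * t"
    and le: "size_bound \<mu> \<epsilon> t x y \<le> D / q * (q ^ j / V x (2 ^ j * t))"
  proof (cases "?d < t")
    case True
    have "size_bound \<mu> \<epsilon> t x y \<le> 1 / V x t * 1"
      unfolding size_bound_def
    proof (rule mult_mono)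
      show "1 / (V x t + V y t + V x ?d) \<le> 1 / V x t"
        using V_pos[OF t, of x] by (intro divide_left_mono mult_pos_pos add_pos_nonneg) auto
      show "t powr \<epsilon> / (t + ?d) powr \<epsilon> \<le> 1"
        using t e powr_mono2[of \<epsilon> t "t + ?d"] by (simp add: divide_le_eq_1)
    qed (use V_pos[OF t, of x] in auto)
    also have "\<dots> \<le> D / q * (q ^ 0 / V x (2 ^ 0 * t))"
    proof -
      have "1 \<le> D / q" using q01 D_ge_1 by simp
      then have "1 * (1 / V x t) \<le> D / q * (1 / V x t)" by (rule mult_right_mono) simp
      then show ?thesis by simp
    qed
    finally show ?thesis using True by (intro that[of 0]) auto
  next
    case False
    obtain k0 :: nat where "?d / t < 2 ^ k0" using real_arch_pow[of 2 "?d / t"] by auto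
    then have ex: "?d < 2 ^ k0 * t" using t by (simp add: field_simps)
    define k where "k = (LEAST k. ?d < 2 ^ k * t)"
    have k1: "?d < 2 ^ k * t" unfolding k_def using ex by (rule LeastI)
    then obtain i where i: "k = Suc i" using False by (cases k) auto
    have k2: "2 ^ i * t \<le> ?d"
      using not_less_Least[of i "\<lambda>k. ?d < 2 ^ k * t"] i by (auto simp: k_def)
    have pos: "0 < 2 ^ i * t" using t by simp
    have Vi: "V x (2 ^ i * t) \<le> V x ?d"
      using k2 pos by (intro V_mono subset_ball) linarith+
    have "size_bound \<mu> \<epsilon> t x y \<le> D / V x (2 ^ k * t) * q ^ i"
      unfolding size_bound_def
    proof (rule mult_mono)
      have "1 / (V x t + V y t + V x ?d) \<le> 1 / V x (2 ^ i * t)"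
        using V_pos[OF pos, of x] Vi by (intro frac_le) (auto intro: add_increasing)
      also have "\<dots> \<le> D / V x (2 ^ k * t)"
        using doubling_step[OF pos, of x] V_pos[OF pos, of x] V_pos[of "2 ^ k * t" x] t
        by (simp add: i field_simps)
      finally show "1 / (V x t + V y t + V x ?d) \<le> D / V x (2 ^ k * t)" .
      have "(2 ^ i) powr \<epsilon> * t powr \<epsilon> = (2 ^ i * t) powr \<epsilon>" using t by (simp add: powr_mult)
      also have "\<dots> \<le> (t + ?d) powr \<epsilon>" using k2 t e pos by (intro powr_mono2) auto
      finally have *: "(2 ^ i) powr \<epsilon> * t powr \<epsilon> \<le> (t + ?d) powr \<epsilon>" .
      have "(2 ^ i) powr \<epsilon> = ((2::real) powr real i) powr \<epsilon>" by (simp add: powr_realpow)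
      also have "\<dots> = inverse (q ^ i)"
        by (simp add: q powr_powr powr_power powr_minus[symmetric] mult.commute)
      finally have "t powr \<epsilon> = q ^ i * ((2 ^ i) powr \<epsilon> * t powr \<epsilon>)" using q01 by simp
      also have "\<dots> \<le> q ^ i * (t + ?d) powr \<epsilon>" using * q01 by (intro mult_left_mono) auto
      finally have "t powr \<epsilon> \<le> q ^ i * (t + ?d) powr \<epsilon>" .
      then show "t powr \<epsilon> / (t + ?d) powr \<epsilon> \<le> q ^ i"
        using t zero_le_dist[of x y] by (subst divide_le_eq) (auto simp: add_pos_nonneg)
    qed (use D_ge_1 in auto)
    also have "\<dots> = D / q * (q ^ k / V x (2 ^ k * t))" using q01 by (simp add: i)
    finally show ?thesis using k1 by (intro that[of k]) auto
  qed
  have "ennreal (size_bound \<mu> \<epsilon> t x y) \<le> ennreal (D / q * (q ^ j / V x (2 ^ j * t)))"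
    by (rule ennreal_leI) (rule le)
  also have "\<dots> = ennreal (D / q) * (ennreal (q ^ j / V x (2 ^ j * t)) * indicator (ball x (2 ^ j * t)) y)"
    using j q01 D_ge_1 by (subst ennreal_mult) auto
  also have "\<dots> \<le> ennreal (D / q) * dyadic_majorant q t x y"
    unfolding dyadic_majorant_def
    using sum_le_suminf[of "\<lambda>j. ennreal (q ^ j / V x (2 ^ j * t)) * indicator (ball x (2 ^ j * t)) y" "{j}"]
    by (intro mult_left_mono) (simp_all del: sum_mult_indicator)
  finally show ?thesis .
qed

text \<open>Bounds \<open>c\<^sub>j\<close> for the averages of \<open>g\<close> over \<open>B(x,2\<^sup>jt)\<close> are summed with the weights.\<close>

lemma majorant_integral_le:
  assumes [measurable]: "g \<in> borel_measurable \<mu>" and t: "0 < t" and q: "0 < q"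
    and c: "\<And>j. 0 \<le> c j" and sm: "summable (\<lambda>j. q ^ j * c j)"
    and le: "\<And>j. (\<integral>\<^sup>+y\<in>ball x (2 ^ j * t). g y \<partial>\<mu>) \<le> ennreal (c j * V x (2 ^ j * t))"
  shows "(\<integral>\<^sup>+y. dyadic_majorant q t x y * g y \<partial>\<mu>) \<le> ennreal (\<Sum>j. q ^ j * c j)"
proof -
  have "(\<integral>\<^sup>+y. dyadic_majorant q t x y * g y \<partial>\<mu>)
      = (\<integral>\<^sup>+y. (\<Sum>j. ennreal (q ^ j / V x (2 ^ j * t)) * (g y * indicator (ball x (2 ^ j * t)) y)) \<partial>\<mu>)"
    unfolding dyadic_majorant_def by (simp add: ennreal_suminf_multc[symmetric] mult_ac)
  also have "\<dots> = (\<Sum>j. \<integral>\<^sup>+y. ennreal (q ^ j / V x (2 ^ j * t)) * (g y * indicator (ball x (2 ^ j * t)) y) \<partial>\<mu>)"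
    by (rule nn_integral_suminf) measurable
  also have "\<dots> = (\<Sum>j. ennreal (q ^ j / V x (2 ^ j * t)) * (\<integral>\<^sup>+y\<in>ball x (2 ^ j * t). g y \<partial>\<mu>))"
    by (subst nn_integral_cmult) auto
  also have "\<dots> \<le> (\<Sum>j. ennreal (q ^ j * c j))"
  proof (rule suminf_le)
    fix j
    have "0 < V x (2 ^ j * t)" using t by (intro V_pos) simp
    then have "ennreal (q ^ j * c j) = ennreal (q ^ j / V x (2 ^ j * t)) * ennreal (c j * V x (2 ^ j * t))"
      using q c[of j] by (subst ennreal_mult[symmetric]) auto
    then show "ennreal (q ^ j / V x (2 ^ j * t)) * (\<integral>\<^sup>+y\<in>ball x (2 ^ j * t). g y \<partial>\<mu>) \<le> ennreal (q ^ j * c j)"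
      using le[of j] by (auto intro: mult_left_mono)
  qed auto
  also have "\<dots> = ennreal (\<Sum>j. q ^ j * c j)"
    using q c sm by (intro suminf_ennreal2) auto
  finally show ?thesis .
qed

end

section \<open>Functions of bounded mean oscillation\<close>

locale bounded_mean_oscillation = doubling_balls +
  fixes f :: "'a \<Rightarrow> complex" and M :: real
  assumes f_loc: "f \<in> L1_loc \<mu>"
    and M_nonneg: "0 \<le> M"
    and osc: "0 < r \<Longrightarrow> (\<integral>\<^sup>+y\<in>ball x r. ennreal (cmod (f y - ball_mean \<mu> x r f)) \<partial>\<mu>)
                       \<le> ennreal (M * V x r)"
begin

lemma f_measurable [measurable]: "f \<in> borel_measurable \<mu>"
  using f_loc by (rule L1_loc_measurable)

lemma mean_diff:
  assumes "0 < r" "dist x y + r \<le> s" "s + dist x y \<le> 2 ^ m * r"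
  shows "cmod (ball_mean \<mu> x r f - ball_mean \<mu> y s f) \<le> D ^ m * M"
proof -
  have s: "0 < s" using assms zero_le_dist[of x y] by linarith
  have sub: "ball x r \<subseteq> ball y s"
  proof
    fix w assume "w \<in> ball x r"
    then show "w \<in> ball y s" using assms dist_triangle[of y w x] by (simp add: dist_commute)
  qed
  have "(\<integral>\<^sup>+w\<in>ball x r. ennreal (cmod (f w - ball_mean \<mu> y s f)) \<partial>\<mu>)
        \<le> (\<integral>\<^sup>+w\<in>ball y s. ennreal (cmod (f w - ball_mean \<mu> y s f)) \<partial>\<mu>)"
    using sub by (intro nn_integral_mono) (auto simp: indicator_def)
  also have "\<dots> \<le> ennreal (M * V y s)" by (rule osc) fact
  also have "\<dots> \<le> ennreal (M * (D ^ m * V x r))"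
    using V_compare[OF assms(1,3)] M_nonneg by (intro ennreal_leI mult_left_mono)
  finally have "cmod (ball_mean \<mu> x r f - ball_mean \<mu> y s f) * V x r \<le> (D ^ m * M) * V x r"
    using M_nonneg D_ge_1 f_loc assms(1) by (subst mean_deviation) (auto simp: mult_ac)
  then show ?thesis using V_pos[OF assms(1), of x] by simp
qed

text \<open>Both balls are compared with \<open>B(y,8r)\<close>, which contains them.\<close>

lemma mean_near:
  assumes "0 < r" "dist x y \<le> 2 * r" "r \<le> s" "s \<le> 2 * r"
  shows "cmod (ball_mean \<mu> x r f - ball_mean \<mu> y s f) \<le> 2 * D ^ 4 * M"
proof -
  have "cmod (ball_mean \<mu> x r f - ball_mean \<mu> y (8 * r) f) \<le> D ^ 4 * M"
    using assms by (intro mean_diff) auto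
  moreover have "cmod (ball_mean \<mu> y s f - ball_mean \<mu> y (8 * r) f) \<le> D ^ 4 * M"
    using assms by (intro mean_diff) auto
  ultimately show ?thesis
    using norm_triangle_ineq4[of "ball_mean \<mu> x r f - ball_mean \<mu> y (8 * r) f"
       "ball_mean \<mu> y s f - ball_mean \<mu> y (8 * r) f"] by simp
qed

lemma mean_dyadic:
  assumes "0 < r"
  shows "cmod (ball_mean \<mu> x (2 ^ k * r) f - ball_mean \<mu> x r f) \<le> real k * (D * M)"
proof (induction k)
  case (Suc k)
  have "cmod (ball_mean \<mu> x (2 ^ k * r) f - ball_mean \<mu> x (2 ^ Suc k * r) f) \<le> D ^ 1 * M"
    using assms by (intro mean_diff) auto
  with Suc show ?case
    using norm_triangle_ineq4[of "ball_mean \<mu> x (2 ^ k * r) f - ball_mean \<mu> x r f"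
      "ball_mean \<mu> x (2 ^ k * r) f - ball_mean \<mu> x (2 ^ Suc k * r) f"]
    by (simp add: algebra_simps norm_minus_commute)
qed simp

lemma majorant_osc:
  assumes t: "0 < t" and q: "0 < q" "q < 1" and b: "0 \<le> b" "cmod (ball_mean \<mu> x t f - z) \<le> b"
  shows "(\<integral>\<^sup>+y. dyadic_majorant q t x y * ennreal (cmod (f y - z)) \<partial>\<mu>) \<le> ennreal (tail_sum q * (M + b))"
proof -
  define c where "c j = (1 + real j * D) * (M + b)" for j
  have sums: "(\<lambda>j. q ^ j * c j) sums (tail_sum q * (M + b))"
    using sums_mult2[OF summable_sums[OF tail_sum_summable[OF q]], of "M + b"]
    by (simp add: c_def tail_sum_def mult.assoc)
  have "(\<integral>\<^sup>+y. dyadic_majorant q t x y * ennreal (cmod (f y - z)) \<partial>\<mu>) \<le> ennreal (\<Sum>j. q ^ j * c j)"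
  proof (rule majorant_integral_le)
    show "0 \<le> c j" for j using M_nonneg b D_ge_1 by (simp add: c_def)
    show "summable (\<lambda>j. q ^ j * c j)" using sums by (rule sums_summable)
    fix j
    define m where "m = ball_mean \<mu> x (2 ^ j * t) f"
    have "cmod (m - z) \<le> real j * (D * M) + b"
      using norm_triangle_ineq[of "m - ball_mean \<mu> x t f" "ball_mean \<mu> x t f - z"]
        mean_dyadic[OF t, of x j] b by (simp add: m_def)
    then have "(\<integral>\<^sup>+y\<in>ball x (2 ^ j * t). ennreal (cmod (f y - z)) \<partial>\<mu>)
        \<le> ennreal ((M + (real j * (D * M) + b)) * V x (2 ^ j * t))"
      using t b M_nonneg D_ge_1 osc[of "2 ^ j * t" x] by (intro recentre[of f _ _ _ m]) (auto simp: m_def)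
    also have "\<dots> \<le> ennreal (c j * V x (2 ^ j * t))"
      using b D_ge_1 by (intro ennreal_leI mult_right_mono) (auto simp: c_def algebra_simps)
    finally show "(\<integral>\<^sup>+y\<in>ball x (2 ^ j * t). ennreal (cmod (f y - z)) \<partial>\<mu>) \<le> ennreal (c j * V x (2 ^ j * t))" .
  qed (use t q in auto)
  then show ?thesis using sums by (simp add: sums_iff)
qed

text \<open>This is used twice: with \<open>z\<close> the mean of \<open>f\<close> and \<open>b = 0\<close> to compare \<open>S\<^sub>t f\<close> with the mean, and
  with \<open>z = 0\<close> for a difference of two kernels to obtain continuity.\<close>

lemma kernel_integral_le:
  assumes t: "0 < t" and e: "0 < \<epsilon>" and q: "q = 2 powr - \<epsilon>" and A: "0 \<le> A"
    and [measurable]: "k \<in> borel_measurable \<mu>"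
    and k: "\<And>y. cmod (k y) \<le> A * size_bound \<mu> \<epsilon> t x y"
    and b: "0 \<le> b" "cmod (ball_mean \<mu> x t f - z) \<le> b"
  shows "integrable \<mu> (\<lambda>y. k y * (f y - z))"
    and "cmod (\<integral>y. k y * (f y - z) \<partial>\<mu>) \<le> A * (D / q * tail_sum q) * (M + b)"
proof -
  have q01: "0 < q" "q < 1" using e by (auto simp: q powr_minus_divide)
  have T: "0 \<le> tail_sum q"
    unfolding tail_sum_def using q01 D_ge_1 by (intro suminf_nonneg tail_sum_summable) auto
  have [measurable]: "dyadic_majorant q t x \<in> borel_measurable \<mu>"
    unfolding dyadic_majorant_def[abs_def] by measurable
  have "(\<integral>\<^sup>+y. ennreal (cmod (k y * (f y - z))) \<partial>\<mu>)
      \<le> (\<integral>\<^sup>+y. ennreal (A * (D / q)) * (dyadic_majorant q t x y * ennreal (cmod (f y - z))) \<partial>\<mu>)"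
  proof (rule nn_integral_mono)
    fix y
    have "ennreal (cmod (k y)) \<le> ennreal A * ennreal (size_bound \<mu> \<epsilon> t x y)"
      using k[of y] A by (simp add: ennreal_mult'[symmetric] ennreal_leI)
    also have "\<dots> \<le> ennreal A * (ennreal (D / q) * dyadic_majorant q t x y)"
      by (intro mult_left_mono size_bound_le_majorant t e q) auto
    also have "\<dots> = ennreal (A * (D / q)) * dyadic_majorant q t x y"
    proof -
      have "ennreal (A * (D / q)) = ennreal A * ennreal (D / q)"
        using A D_ge_1 q01 by (intro ennreal_mult) auto
      then show ?thesis by (simp only: mult.assoc)
    qed
    finally have "ennreal (cmod (k y)) * ennreal (cmod (f y - z))
        \<le> ennreal (A * (D / q)) * dyadic_majorant q t x y * ennreal (cmod (f y - z))"
      by (rule mult_right_mono) simp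
    then show "ennreal (cmod (k y * (f y - z)))
        \<le> ennreal (A * (D / q)) * (dyadic_majorant q t x y * ennreal (cmod (f y - z)))"
      by (simp add: norm_mult ennreal_mult mult.assoc)
  qed
  also have "\<dots> = ennreal (A * (D / q)) * (\<integral>\<^sup>+y. dyadic_majorant q t x y * ennreal (cmod (f y - z)) \<partial>\<mu>)"
    by (rule nn_integral_cmult) measurable
  also have "\<dots> \<le> ennreal (A * (D / q)) * ennreal (tail_sum q * (M + b))"
    by (intro mult_left_mono majorant_osc t q01 b) simp
  also have "\<dots> = ennreal (A * (D / q * tail_sum q) * (M + b))"
    using A D_ge_1 q01 T M_nonneg b by (subst ennreal_mult[symmetric]) (auto simp: mult_ac)
  finally have le: "(\<integral>\<^sup>+y. ennreal (cmod (k y * (f y - z))) \<partial>\<mu>) \<le> ennreal (A * (D / q * tail_sum q) * (M + b))" .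
  show i: "integrable \<mu> (\<lambda>y. k y * (f y - z))"
  proof (rule integrableI_bounded)
    show "(\<integral>\<^sup>+y. ennreal (norm (k y * (f y - z))) \<partial>\<mu>) < \<infinity>"
      using le_less_trans[OF le ennreal_less_top] by simp
  qed measurable
  have "ennreal (cmod (\<integral>y. k y * (f y - z) \<partial>\<mu>)) \<le> ennreal (A * (D / q * tail_sum q) * (M + b))"
    using integral_norm_bound_ennreal[OF i] le by (rule order_trans)
  then show "cmod (\<integral>y. k y * (f y - z) \<partial>\<mu>) \<le> A * (D / q * tail_sum q) * (M + b)"
    using A D_ge_1 q01 T M_nonneg b by (subst (asm) ennreal_le_iff) auto
qed

text \<open>As \<open>k\<close> has integral one, the difference is the integral of \<open>k (f - a)\<close> with \<open>a\<close> the mean.\<close>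

lemma kernel_integral_near_mean:
  assumes t: "0 < t" and e: "0 < \<epsilon>" and q: "q = 2 powr - \<epsilon>" and A: "0 \<le> A"
    and ki: "integrable \<mu> k" and k1: "(\<integral>y. k y \<partial>\<mu>) = 1"
    and k: "\<And>y. cmod (k y) \<le> A * size_bound \<mu> \<epsilon> t x y"
  shows "cmod ((\<integral>y. k y * f y \<partial>\<mu>) - ball_mean \<mu> x t f) \<le> A * (D / q * tail_sum q) * M"
proof -
  define a where "a = ball_mean \<mu> x t f"
  have km: "k \<in> borel_measurable \<mu>" using ki by (rule borel_measurable_integrable)
  note * = kernel_integral_le[OF t e q A km k, of 0 a]
  have i: "integrable \<mu> (\<lambda>y. k y * (f y - a))" using * by (simp add: a_def)
  have "(\<integral>y. k y * f y \<partial>\<mu>) = (\<integral>y. k y * (f y - a) + k y * a \<partial>\<mu>)"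
    by (simp add: algebra_simps)
  also have "\<dots> = (\<integral>y. k y * (f y - a) \<partial>\<mu>) + a"
    using i ki k1 by (subst Bochner_Integration.integral_add) auto
  finally show ?thesis using * by (simp add: a_def)
qed

end

section \<open>The maximal oscillation over dyadic scales\<close>

text \<open>Only finitely many scales are admitted, so that an a priori bound and a finite covering are
  available.\<close>

definition dyadic_osc :: "('a \<Rightarrow> real \<Rightarrow> complex) \<Rightarrow> nat \<Rightarrow> 'a \<Rightarrow> real \<Rightarrow> ennreal" where
  "dyadic_osc u n x R = (SUP k\<in>{..n}. ennreal (cmod (u x (R / 2 ^ k) - u x R)))"

definition dyadic_max :: "('a \<Rightarrow> real \<Rightarrow> complex) \<Rightarrow> 'a \<Rightarrow> real \<Rightarrow> ennreal" where
  "dyadic_max u x R = (SUP k. ennreal (cmod (u x (R / 2 ^ k) - u x R)))"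

lemma sum_nn_integral_disjoint_le:
  assumes "finite A" "disjoint_family_on B A" "\<And>z. z \<in> A \<Longrightarrow> B z \<in> sets M"
    and "\<And>z. z \<in> A \<Longrightarrow> B z \<subseteq> U" and [measurable]: "g \<in> borel_measurable M"
  shows "(\<Sum>z\<in>A. \<integral>\<^sup>+y\<in>B z. g y \<partial>M) \<le> (\<integral>\<^sup>+y\<in>U. g y \<partial>M)"
proof -
  have "(\<Sum>z\<in>A. \<integral>\<^sup>+y\<in>B z. g y \<partial>M) = (\<integral>\<^sup>+y. (\<Sum>z\<in>A. g y * indicator (B z) y) \<partial>M)"
    using assms(3) by (intro nn_integral_sum[symmetric] borel_measurable_times_ennreal
      borel_measurable_indicator) auto
  also have "\<dots> \<le> (\<integral>\<^sup>+y\<in>U. g y \<partial>M)"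
  proof (rule nn_integral_mono)
    fix y
    show "(\<Sum>z\<in>A. g y * indicator (B z) y) \<le> g y * indicator U y"
    proof (cases "\<exists>z\<in>A. y \<in> B z")
      case True
      then obtain z where z: "z \<in> A" "y \<in> B z" by blast
      then have "(\<Sum>z\<in>A. g y * indicator (B z) y) = g y"
        using assms(1,2) by (subst sum_indicator_disjoint_family) auto
      then show ?thesis using z assms(4) by (auto simp: indicator_def)
    next
      case False
      then show ?thesis by (simp add: indicator_def)
    qed
  qed
  finally show ?thesis .
qed

text \<open>The features shared by the means \<open>a(x,r)\<close> and by \<open>S\<^sub>r f(x)\<close> that matter below. The means
  themselves need not be continuous in \<open>x\<close>, which is why \<open>S\<^sub>r f\<close> takes their place.\<close>

locale averaging_family = doubling_balls +
  fixes f :: "'a \<Rightarrow> complex" and u :: "'a \<Rightarrow> real \<Rightarrow> complex" and L :: real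
  assumes L_pos: "0 < L"
    and f_meas [measurable]: "f \<in> borel_measurable \<mu>"
    and u_cont: "0 < s \<Longrightarrow> continuous_on UNIV (\<lambda>x. u x s)"
    and u_near: "0 < r \<Longrightarrow> dist x y \<le> 2 * r \<Longrightarrow> r \<le> s \<Longrightarrow> s \<le> 2 * r \<Longrightarrow> cmod (u x r - u y s) \<le> L"
    and u_osc: "0 < s \<Longrightarrow> (\<integral>\<^sup>+y\<in>ball x s. ennreal (cmod (f y - u x s)) \<partial>\<mu>) \<le> ennreal (L * V x s)"
begin

lemma u_meas: "0 < s \<Longrightarrow> (\<lambda>x. u x s) \<in> borel_measurable \<mu>"
  by (intro borel_measurable_transfer borel_measurable_continuous_onI u_cont)

lemma dyadic_osc_measurable:
  assumes "0 < R"
  shows "(\<lambda>x. dyadic_osc u n x R) \<in> borel_measurable \<mu>"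
proof -
  have [measurable]: "(\<lambda>x. u x (R / 2 ^ k)) \<in> borel_measurable \<mu>" "(\<lambda>x. u x R) \<in> borel_measurable \<mu>" for k
    using assms by (auto intro: u_meas)
  show ?thesis unfolding dyadic_osc_def by measurable
qed

lemma u_dyadic:
  assumes "0 < R"
  shows "cmod (u x (R / 2 ^ k) - u x R) \<le> real k * L"
proof (induction k)
  case (Suc k)
  have "cmod (u x (R / 2 ^ Suc k) - u x (R / 2 ^ k)) \<le> L"
    using assms by (intro u_near) (auto simp: field_simps)
  with Suc show ?case
    using norm_triangle_ineq[of "u x (R / 2 ^ Suc k) - u x (R / 2 ^ k)" "u x (R / 2 ^ k) - u x R"]
    by (simp add: algebra_simps)
qed simp

lemma dyadic_osc_trivial:
  assumes "0 < R"
  shows "dyadic_osc u n x R \<le> ennreal (real n * L)"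
  unfolding dyadic_osc_def
proof (rule SUP_least)
  fix k assume "k \<in> {..n}"
  have "cmod (u x (R / 2 ^ k) - u x R) \<le> real k * L" by (rule u_dyadic) fact
  also have "\<dots> \<le> real n * L" using \<open>k \<in> {..n}\<close> L_pos by (intro mult_right_mono) auto
  finally show "ennreal (cmod (u x (R / 2 ^ k) - u x R)) \<le> ennreal (real n * L)" by (rule ennreal_leI)
qed

text \<open>The Calderon--Zygmund step. For a point \<open>z\<close> that stops at radius \<open>r(z)\<close>, the average of
  \<open>|f - u(x\<^sub>0,2R)|\<close> over \<open>B(z,r(z))\<close> is at least of order \<open>\<lambda>\<close>, so disjoint stopped balls have small
  total measure when \<open>\<lambda>\<close> is a large multiple of \<open>L\<close>. At radius \<open>2r(z)\<close>, the last one before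
  stopping, all oscillations are still at most \<open>\<lambda>\<close>; hence on \<open>B(z,2r(z))\<close> the coarse scales
  contribute at most \<open>\<lambda> + 2L\<close> and the fine ones are governed by the assumed bound on that ball.\<close>

lemma stopping_time_improvement:
  assumes M: "0 \<le> M" and R: "0 < R"
    and IH: "\<And>z s. 0 < s \<Longrightarrow> (\<integral>\<^sup>+x\<in>ball z s. dyadic_osc u n x s \<partial>\<mu>) \<le> ennreal (M * V z s)"
  shows "(\<integral>\<^sup>+x\<in>ball x0 R. dyadic_osc u n x R \<partial>\<mu>) \<le> ennreal (((4 + 2 * D^2) * L + M / 2) * V x0 R)"
proof -
  \<comment> \<open>With this threshold the balls \<open>B(z,2r(z))\<close> below fill at most half of the measure of \<open>B(x\<^sub>0,R)\<close>.\<close>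
  define lam where "lam = (2 + 2 * D^2) * L"
  define q where "q x k = cmod (u x (R / 2 ^ k) - u x R)" for x k
  define E where "E = {x \<in> ball x0 R. \<exists>k\<le>n. lam < q x k}"
  define K where "K x = (LEAST k. lam < q x k)" for x
  define r where "r x = R / 2 ^ K x" for x
  define B where "B x = ball x (r x)" for x
  have lam_pos: "0 < lam" using L_pos D_ge_1 by (simp add: lam_def add_pos_nonneg)
  have K_gt: "lam < q x (K x)" and K_le: "K x \<le> n" if x: "x \<in> E" for x
  proof -
    obtain k where k: "k \<le> n" "lam < q x k" using x by (auto simp: E_def)
    show "lam < q x (K x)" unfolding K_def using k(2) by (rule LeastI)
    show "K x \<le> n" using Least_le[of "\<lambda>k. lam < q x k", OF k(2)] k(1) by (simp add: K_def)
  qed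
  have K_below: "q x k \<le> lam" if "k < K x" for x k
    using not_less_Least[of k "\<lambda>k. lam < q x k"] that by (simp add: K_def)
  have K_pos: "0 < K x" if "x \<in> E" for x
    using K_gt[OF that] lam_pos by (cases "K x") (auto simp: q_def)
  have r_pos: "0 < r x" for x using R by (simp add: r_def)
  have r_le: "r x \<le> R" for x using R by (simp add: r_def divide_le_eq)
  have B_sub: "B z \<subseteq> ball x0 (2 * R)" if "z \<in> E" for z
  proof
    fix w assume "w \<in> B z"
    then show "w \<in> ball x0 (2 * R)"
      using that r_le[of z] dist_triangle[of x0 w z] by (simp add: B_def E_def)
  qed
  have B_sets: "B z \<in> sets \<mu>" for z by (simp add: B_def)
  \<comment> \<open>Disjoint stopped balls lie in \<open>B(x\<^sub>0,2R)\<close> and, as their radii are at least \<open>R / 2\<^sup>n\<close>, each of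
    them has a fixed proportion of its measure, so their number is bounded.\<close>
  have pack: "(\<Sum>z\<in>F. V z (r z)) \<le> V x0 (2 * R)"
    if "finite F" "F \<subseteq> E" "disjoint_family_on B F" for F
  proof -
    have "(\<Sum>z\<in>F. \<integral>\<^sup>+y\<in>B z. 1 \<partial>\<mu>) \<le> (\<integral>\<^sup>+y\<in>ball x0 (2 * R). 1 \<partial>\<mu>)"
      using that B_sub B_sets by (intro sum_nn_integral_disjoint_le) auto
    then have "(\<Sum>z\<in>F. ennreal (V z (r z))) \<le> ennreal (V x0 (2 * R))"
      using R by (simp add: B_def emeasure_ball_eq r_pos)
    then show ?thesis by (simp add: sum_ennreal)
  qed
  have "\<exists>A. finite A \<and> A \<subseteq> E \<and> disjoint_family_on B A \<and>
           (\<forall>x\<in>E. \<exists>z\<in>A. r x \<le> r z \<and> B x \<inter> B z \<noteq> {})"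
  proof (rule vitali_finite_selection)
    have "r ` E \<subseteq> (\<lambda>k. R / 2 ^ k) ` {..n}" using K_le by (auto simp: r_def)
    then show "finite (r ` E)" by (rule finite_subset) simp
    show "B x \<noteq> {}" for x using r_pos[of x] by (simp add: B_def)
    fix F assume F: "finite F" "F \<subseteq> E" "disjoint_family_on B F"
    have "V x0 (2 * R) \<le> D ^ (n + 2) * V z (r z)" if "z \<in> F" for z
    proof (rule V_compare)
      show "0 < r z" by (rule r_pos)
      have z: "z \<in> E" using that F by auto
      have "(2::real) ^ K z \<le> 2 ^ n" using K_le[OF z] by (intro power_increasing) auto
      then have "R \<le> 2 ^ n * r z" using R by (simp add: r_def field_simps)
      then show "2 * R + dist z x0 \<le> 2 ^ (n + 2) * r z"
        using z R by (simp add: E_def dist_commute)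
    qed
    then have "(\<Sum>z\<in>F. V x0 (2 * R)) \<le> (\<Sum>z\<in>F. D ^ (n + 2) * V z (r z))" by (rule sum_mono)
    also have "\<dots> = D ^ (n + 2) * (\<Sum>z\<in>F. V z (r z))" by (simp add: sum_distrib_left)
    also have "\<dots> \<le> D ^ (n + 2) * V x0 (2 * R)"
      using D_ge_1 pack[OF F] by (intro mult_left_mono) auto
    finally have "real (card F) * V x0 (2 * R) \<le> D ^ (n + 2) * V x0 (2 * R)" by simp
    then have "real (card F) \<le> D ^ (n + 2)" using V_pos[of "2 * R" x0] R by simp
    then show "card F \<le> nat \<lfloor>D ^ (n + 2)\<rfloor>" by linarith
  qed
  then obtain A where A: "finite A" "A \<subseteq> E" "disjoint_family_on B A"
      and cover: "\<And>x. x \<in> E \<Longrightarrow> \<exists>z\<in>A. r x \<le> r z \<and> B x \<inter> B z \<noteq> {}" by metis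
  define s where "s = (\<Sum>z\<in>A. V z (r z))"
  have s_nonneg: "0 \<le> s" by (simp add: s_def sum_nonneg)
  \<comment> \<open>The stopped balls are small in total because \<open>f\<close> deviates there from \<open>u(x\<^sub>0,2R)\<close> by about \<open>\<lambda>\<close>.\<close>
  have s_le: "2 * D * s \<le> V x0 R"
  proof -
    define c where "c = u x0 (2 * R)"
    have lam_L: "0 \<le> lam - L" using L_pos by (simp add: lam_def algebra_simps)
    have each: "ennreal ((lam - L) * V z (r z))
        \<le> (\<integral>\<^sup>+y\<in>B z. ennreal (cmod (f y - c)) \<partial>\<mu>) + ennreal (L * V z (r z))" if "z \<in> A" for z
    proof -
      have z: "z \<in> E" using that A by auto
      have "cmod (u z R - c) \<le> L"
        unfolding c_def using z R by (intro u_near) (auto simp: E_def dist_commute)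
      moreover have "lam < cmod (u z (r z) - u z R)" using K_gt[OF z] by (simp add: q_def r_def)
      ultimately have far: "lam - L \<le> cmod (u z (r z) - c)"
        using norm_triangle_ineq4[of "u z (r z) - c" "u z R - c"] by simp
      have "ennreal ((lam - L) * V z (r z)) = (\<integral>\<^sup>+y\<in>B z. ennreal (lam - L) \<partial>\<mu>)"
        unfolding B_def using L_pos D_ge_1 r_pos
        by (intro nn_integral_const_ball[symmetric]) (auto simp: lam_def algebra_simps)
      also have "\<dots> \<le> (\<integral>\<^sup>+y. (ennreal (cmod (f y - c)) * indicator (B z) y
          + ennreal (cmod (f y - u z (r z))) * indicator (B z) y) \<partial>\<mu>)"
      proof (rule nn_integral_mono)
        fix y
        have "lam - L \<le> cmod (f y - c) + cmod (f y - u z (r z))"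
          using far norm_triangle_ineq4[of "f y - c" "f y - u z (r z)"] by simp
        then have "ennreal (lam - L) \<le> ennreal (cmod (f y - c)) + ennreal (cmod (f y - u z (r z)))"
          by (simp flip: ennreal_plus)
        then show "ennreal (lam - L) * indicator (B z) y \<le> ennreal (cmod (f y - c)) * indicator (B z) y
          + ennreal (cmod (f y - u z (r z))) * indicator (B z) y" by (auto simp: indicator_def)
      qed
      also have "\<dots> = (\<integral>\<^sup>+y\<in>B z. ennreal (cmod (f y - c)) \<partial>\<mu>)
          + (\<integral>\<^sup>+y\<in>B z. ennreal (cmod (f y - u z (r z))) \<partial>\<mu>)"
        unfolding B_def by (rule nn_integral_add) measurable
      also have "\<dots> \<le> (\<integral>\<^sup>+y\<in>B z. ennreal (cmod (f y - c)) \<partial>\<mu>) + ennreal (L * V z (r z))"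
        unfolding B_def by (intro add_left_mono u_osc r_pos)
      finally show ?thesis .
    qed
    have "ennreal ((lam - L) * s) = (\<Sum>z\<in>A. ennreal ((lam - L) * V z (r z)))"
      using lam_L by (subst sum_ennreal) (auto simp: s_def sum_distrib_left)
    also have "\<dots> \<le> (\<Sum>z\<in>A. (\<integral>\<^sup>+y\<in>B z. ennreal (cmod (f y - c)) \<partial>\<mu>) + ennreal (L * V z (r z)))"
      by (rule sum_mono) (rule each)
    also have "\<dots> = (\<Sum>z\<in>A. \<integral>\<^sup>+y\<in>B z. ennreal (cmod (f y - c)) \<partial>\<mu>) + ennreal (L * s)"
      using L_pos by (simp add: sum.distrib sum_ennreal s_def sum_distrib_left)
    also have "(\<Sum>z\<in>A. \<integral>\<^sup>+y\<in>B z. ennreal (cmod (f y - c)) \<partial>\<mu>)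
        \<le> (\<integral>\<^sup>+y\<in>ball x0 (2 * R). ennreal (cmod (f y - c)) \<partial>\<mu>)"
      using A B_sub B_sets by (intro sum_nn_integral_disjoint_le) auto
    also have "\<dots> \<le> ennreal (L * V x0 (2 * R))"
      unfolding c_def using R by (intro u_osc) simp
    also have "\<dots> \<le> ennreal (L * (D * V x0 R))"
      using R L_pos by (intro ennreal_leI mult_left_mono doubling_step) auto
    finally have "ennreal ((lam - L) * s) \<le> ennreal (L * (D * V x0 R) + L * s)"
      using L_pos D_ge_1 s_nonneg by simp
    then have "(lam - L) * s \<le> L * (D * V x0 R) + L * s"
      using L_pos D_ge_1 s_nonneg by (subst (asm) ennreal_le_iff) auto
    then have "(L * D) * (2 * D * s) \<le> (L * D) * V x0 R"
      by (simp add: lam_def algebra_simps power2_eq_square)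
    then show ?thesis using L_pos D_ge_1 by simp
  qed
  have pointwise: "dyadic_osc u n x R
      \<le> ennreal (lam + 2 * L) + (\<Sum>z\<in>A. dyadic_osc u n x (2 * r z) * indicator (ball z (2 * r z)) x)"
    if x: "x \<in> ball x0 R" for x
  proof (cases "x \<in> E")
    case False
    then have "dyadic_osc u n x R \<le> ennreal lam"
      unfolding dyadic_osc_def using x
      by (intro SUP_least ennreal_leI) (force simp: E_def q_def not_less)
    also have "\<dots> \<le> ennreal (lam + 2 * L)" using L_pos by (intro ennreal_leI) simp
    finally show ?thesis by (rule order_trans) (simp add: add_increasing2)
  next
    case True
    then obtain z where z: "z \<in> A" "r x \<le> r z" "B x \<inter> B z \<noteq> {}" using cover by blast
    have zE: "z \<in> E" using z A by auto
    \<comment> \<open>\<open>m\<close> is the last scale of \<open>z\<close> before stopping, with radius \<open>2 r(z)\<close>.\<close>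
    obtain m where m: "K z = Suc m" using K_pos[OF zE] by (cases "K z") auto
    have rz: "2 * r z = R / 2 ^ m" by (simp add: r_def m)
    obtain w where w: "w \<in> B x" "w \<in> B z" using z by blast
    have dxz: "dist x z < 2 * r z"
      using w z(2) dist_triangle2[of x z w] by (simp add: B_def dist_commute)
    have dist_le: "dist x z \<le> 2 * (R / 2 ^ k)" if "k \<le> m" for k
    proof -
      have "R / 2 ^ m \<le> R / 2 ^ k" using that R by (intro divide_left_mono power_increasing) auto
      then show ?thesis using dxz rz r_pos[of z] by simp
    qed
    have coarse: "q x k \<le> lam + 2 * L" if "k \<le> m" for k
    proof -
      have "cmod (u x (R / 2 ^ k) - u z (R / 2 ^ k)) \<le> L"
      proof (rule u_near)
        show pos: "0 < R / 2 ^ k" using R by simp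
        then show "R / 2 ^ k \<le> 2 * (R / 2 ^ k)" by linarith
      qed (use dist_le[OF that] in auto)
      moreover have "cmod (u x R - u z R) \<le> L"
        using R dist_le[of 0] by (intro u_near) auto
      moreover have "q z k \<le> lam" using that m by (intro K_below) simp
      moreover have "q x k \<le> cmod (u x (R / 2 ^ k) - u z (R / 2 ^ k)) + q z k + cmod (u x R - u z R)"
        unfolding q_def by norm
      ultimately show ?thesis by linarith
    qed
    have "dyadic_osc u n x R \<le> ennreal (lam + 2 * L) + dyadic_osc u n x (2 * r z)"
      unfolding dyadic_osc_def[of u n x R]
    proof (rule SUP_least)
      fix k assume k: "k \<in> {..n}"
      show "ennreal (cmod (u x (R / 2 ^ k) - u x R)) \<le> ennreal (lam + 2 * L) + dyadic_osc u n x (2 * r z)"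
      proof (cases "k \<le> m")
        case True
        have "ennreal (cmod (u x (R / 2 ^ k) - u x R)) \<le> ennreal (lam + 2 * L)"
          using coarse[OF True] by (intro ennreal_leI) (simp add: q_def)
        then show ?thesis by (rule order_trans) (simp add: add_increasing2)
      next
        case False
        then obtain j where j: "k = m + j" using le_Suc_ex[of m k] by auto
        have eq: "R / 2 ^ k = 2 * r z / 2 ^ j" by (simp add: rz j power_add)
        have "cmod (u x (R / 2 ^ k) - u x R)
            \<le> q x m + cmod (u x (2 * r z / 2 ^ j) - u x (2 * r z))"
          unfolding q_def eq rz by norm
        also have "\<dots> \<le> (lam + 2 * L) + cmod (u x (2 * r z / 2 ^ j) - u x (2 * r z))"
          using coarse[of m] by simp
        finally have "ennreal (cmod (u x (R / 2 ^ k) - u x R))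
            \<le> ennreal (lam + 2 * L) + ennreal (cmod (u x (2 * r z / 2 ^ j) - u x (2 * r z)))"
          using lam_pos L_pos by (simp flip: ennreal_plus)
        also have "\<dots> \<le> ennreal (lam + 2 * L) + dyadic_osc u n x (2 * r z)"
          unfolding dyadic_osc_def using j k by (intro add_left_mono SUP_upper) auto
        finally show ?thesis .
      qed
    qed
    also have "dyadic_osc u n x (2 * r z) = dyadic_osc u n x (2 * r z) * indicator (ball z (2 * r z)) x"
      using dxz by (simp add: dist_commute)
    also have "\<dots> \<le> (\<Sum>z\<in>A. dyadic_osc u n x (2 * r z) * indicator (ball z (2 * r z)) x)"
      using A(1) z(1) by (rule member_le_sum[rotated 2]) auto
    finally show ?thesis by simp
  qed
  have [measurable]: "(\<lambda>x. dyadic_osc u n x (2 * r z)) \<in> borel_measurable \<mu>" for z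
    using r_pos by (intro dyadic_osc_measurable) simp
  have "(\<integral>\<^sup>+x\<in>ball x0 R. dyadic_osc u n x R \<partial>\<mu>)
      \<le> (\<integral>\<^sup>+x. (ennreal (lam + 2 * L) * indicator (ball x0 R) x
            + (\<Sum>z\<in>A. dyadic_osc u n x (2 * r z) * indicator (ball z (2 * r z)) x)) \<partial>\<mu>)"
    using pointwise by (intro nn_integral_mono) (auto simp: indicator_def)
  also have "\<dots> = (\<integral>\<^sup>+x\<in>ball x0 R. ennreal (lam + 2 * L) \<partial>\<mu>)
        + (\<Sum>z\<in>A. \<integral>\<^sup>+x\<in>ball z (2 * r z). dyadic_osc u n x (2 * r z) \<partial>\<mu>)"
    by (subst nn_integral_add, measurable) (subst nn_integral_sum, measurable)
  also have "\<dots> \<le> ennreal ((lam + 2 * L) * V x0 R) + (\<Sum>z\<in>A. ennreal (M * V z (2 * r z)))"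
    using R r_pos lam_pos L_pos
    by (intro add_mono sum_mono IH) (auto simp: nn_integral_const_ball simp del: ennreal_plus)
  also have "\<dots> \<le> ennreal ((lam + 2 * L) * V x0 R) + (\<Sum>z\<in>A. ennreal (M * (D * V z (r z))))"
    using M r_pos by (intro add_left_mono sum_mono ennreal_leI mult_left_mono doubling_step) auto
  also have "\<dots> = ennreal ((lam + 2 * L) * V x0 R + M * (D * s))"
    using M D_ge_1 lam_pos L_pos
    by (subst sum_ennreal) (auto simp: s_def sum_distrib_left sum_nonneg)
  also have "\<dots> \<le> ennreal (((4 + 2 * D^2) * L + M / 2) * V x0 R)"
  proof (rule ennreal_leI)
    have "M * (2 * D * s) \<le> M * V x0 R" using s_le M by (rule mult_left_mono)
    then show "(lam + 2 * L) * V x0 R + M * (D * s) \<le> ((4 + 2 * D^2) * L + M / 2) * V x0 R"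
      by (simp add: lam_def algebra_simps)
  qed
  finally show ?thesis .
qed

text \<open>Starting from the crude bound \<open>n L\<close>, the improvement \<open>M \<mapsto> c + M/2\<close> is iterated; its fixed
  point \<open>2c\<close> no longer depends on \<open>n\<close>.\<close>

lemma dyadic_osc_integral_le:
  assumes "0 < R"
  shows "(\<integral>\<^sup>+x\<in>ball x0 R. dyadic_osc u n x R \<partial>\<mu>) \<le> ennreal (osc_const * L * V x0 R)"
proof -
  define c where "c = (4 + 2 * D^2) * L"
  have c: "0 \<le> c" using L_pos by (simp add: c_def)
  have *: "0 < s \<Longrightarrow> (\<integral>\<^sup>+x\<in>ball z s. dyadic_osc u n x s \<partial>\<mu>)
      \<le> ennreal ((2 * c + real n * L / 2 ^ m) * V z s)" for m z s
  proof (induction m arbitrary: z s)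
    case 0
    have "(\<integral>\<^sup>+x\<in>ball z s. dyadic_osc u n x s \<partial>\<mu>) \<le> (\<integral>\<^sup>+x\<in>ball z s. ennreal (real n * L) \<partial>\<mu>)"
      using 0 by (intro nn_integral_mono mult_right_mono dyadic_osc_trivial) auto
    also have "\<dots> = ennreal (real n * L * V z s)"
      using 0 L_pos by (intro nn_integral_const_ball) auto
    also have "\<dots> \<le> ennreal ((2 * c + real n * L / 2 ^ 0) * V z s)"
      using c by (intro ennreal_leI mult_right_mono) auto
    finally show ?case .
  next
    case (Suc m)
    have "(\<integral>\<^sup>+x\<in>ball z s. dyadic_osc u n x s \<partial>\<mu>)
      \<le> ennreal (((4 + 2 * D^2) * L + (2 * c + real n * L / 2 ^ m) / 2) * V z s)"
      using Suc c L_pos by (intro stopping_time_improvement) auto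
    also have "(4 + 2 * D^2) * L + (2 * c + real n * L / 2 ^ m) / 2 = 2 * c + real n * L / 2 ^ Suc m"
      by (simp add: c_def field_simps)
    finally show ?case .
  qed
  have "(\<lambda>m. real n * L / 2 ^ m) \<longlonglongrightarrow> 0"
    by (rule LIMSEQ_divide_realpow_zero) simp
  then have "(\<lambda>m. (2 * c + real n * L / 2 ^ m) * V x0 R) \<longlonglongrightarrow> (2 * c + 0) * V x0 R"
    by (intro tendsto_intros)
  then have "(\<lambda>m. ennreal ((2 * c + real n * L / 2 ^ m) * V x0 R)) \<longlonglongrightarrow> ennreal ((2 * c + 0) * V x0 R)"
    by (rule tendsto_ennrealI)
  then have "(\<integral>\<^sup>+x\<in>ball x0 R. dyadic_osc u n x R \<partial>\<mu>) \<le> ennreal ((2 * c + 0) * V x0 R)"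
    using *[OF assms] by (intro LIMSEQ_le_const) auto
  then show ?thesis by (simp add: c_def osc_const_def algebra_simps)
qed

lemma dyadic_max_measurable:
  assumes "0 < R"
  shows "(\<lambda>x. dyadic_max u x R) \<in> borel_measurable \<mu>"
proof -
  have [measurable]: "(\<lambda>x. u x (R / 2 ^ k)) \<in> borel_measurable \<mu>" "(\<lambda>x. u x R) \<in> borel_measurable \<mu>" for k
    using assms by (auto intro: u_meas)
  show ?thesis unfolding dyadic_max_def by measurable
qed

lemma dyadic_max_integral_le:
  assumes "0 < R"
  shows "(\<integral>\<^sup>+x\<in>ball x0 R. dyadic_max u x R \<partial>\<mu>) \<le> ennreal (osc_const * L * V x0 R)"
proof -
  have max_eq: "dyadic_max u x R = (SUP n. dyadic_osc u n x R)" for x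
    unfolding dyadic_max_def dyadic_osc_def
  proof (intro antisym SUP_least)
    fix k :: nat
    show "ennreal (cmod (u x (R / 2 ^ k) - u x R))
        \<le> (SUP n. SUP k\<in>{..n}. ennreal (cmod (u x (R / 2 ^ k) - u x R)))"
      by (rule SUP_upper2[of k]) (auto intro: SUP_upper)
  qed (auto intro: SUP_upper)
  have "(\<integral>\<^sup>+x\<in>ball x0 R. dyadic_max u x R \<partial>\<mu>)
      = (\<integral>\<^sup>+x. (SUP n. dyadic_osc u n x R * indicator (ball x0 R) x) \<partial>\<mu>)"
    by (simp add: max_eq SUP_mult_right_ennreal)
  also have "\<dots> = (SUP n. \<integral>\<^sup>+x\<in>ball x0 R. dyadic_osc u n x R \<partial>\<mu>)"
  proof (rule nn_integral_monotone_convergence_SUP)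
    show "incseq (\<lambda>n x. dyadic_osc u n x R * indicator (ball x0 R) x)"
      unfolding dyadic_osc_def by (intro incseq_SucI le_funI mult_right_mono SUP_subset_mono) auto
    show "(\<lambda>x. dyadic_osc u n x R * indicator (ball x0 R) x) \<in> borel_measurable \<mu>" for n
      using dyadic_osc_measurable[OF assms, of n] by measurable
  qed
  also have "\<dots> \<le> ennreal (osc_const * L * V x0 R)"
    using assms by (intro SUP_least dyadic_osc_integral_le)
  finally show ?thesis .
qed

lemma u_le_dyadic_max:
  assumes "0 < t" "t \<le> R"
  shows "ennreal (cmod (u x t)) \<le> ennreal (cmod (u x R)) + ennreal L + dyadic_max u x R"
proof -
  obtain k0 :: nat where "R / t < 2 ^ k0" using real_arch_pow[of 2 "R / t"] by auto
  then have ex: "R / 2 ^ k0 < t" using assms by (simp add: field_simps)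
  define k where "k = (LEAST k. R / 2 ^ Suc k < t)"
  have "R / 2 ^ Suc k0 < t" using ex assms by (simp add: field_simps)
  then have k1: "R / 2 ^ Suc k < t" unfolding k_def by (rule LeastI)
  have k2: "t \<le> R / 2 ^ k"
  proof (cases k)
    case 0 then show ?thesis using assms by simp
  next
    case (Suc j)
    then show ?thesis using not_less_Least[of j "\<lambda>k. R / 2 ^ Suc k < t"] by (auto simp: k_def)
  qed
  have "cmod (u x t - u x (R / 2 ^ k)) \<le> L"
    using assms k1 k2 by (intro u_near) (auto simp: field_simps)
  then have "cmod (u x t) \<le> cmod (u x R) + L + cmod (u x (R / 2 ^ k) - u x R)"
    using norm_triangle_ineq[of "u x t - u x (R / 2 ^ k)" "u x (R / 2 ^ k) - u x R + u x R"]
      norm_triangle_ineq[of "u x (R / 2 ^ k) - u x R" "u x R"] by simp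
  then have "ennreal (cmod (u x t))
      \<le> ennreal (cmod (u x R)) + ennreal L + ennreal (cmod (u x (R / 2 ^ k) - u x R))"
    using L_pos by (simp flip: ennreal_plus)
  also have "\<dots> \<le> ennreal (cmod (u x R)) + ennreal L + dyadic_max u x R"
    unfolding dyadic_max_def by (intro add_left_mono SUP_upper) auto
  finally show ?thesis .
qed

section \<open>The radial maximal function of an averaging family\<close>

definition radial_sup :: "'a \<Rightarrow> ennreal" where
  "radial_sup x = (SUP t\<in>{0<..}. ennreal (cmod (u x t)))"

text \<open>A supremum of arbitrarily many continuous functions is lower semicontinuous.\<close>

lemma radial_sup_measurable [measurable]: "radial_sup \<in> borel_measurable \<mu>"
proof (rule borel_measurable_transfer, rule borel_measurableI_greater)
  fix c :: ennreal
  have "{x \<in> space borel. c < radial_sup x} = (\<Union>t\<in>{0<..}. {x. c < ennreal (cmod (u x t))})"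
    by (auto simp: radial_sup_def less_SUP_iff)
  moreover have "open (\<Union>t\<in>{0<..}. {x. c < ennreal (cmod (u x t))})"
    by (intro open_UN ballI open_Collect_less continuous_intros continuous_on_ennreal u_cont) auto
  ultimately show "{x \<in> space borel. c < radial_sup x} \<in> sets borel" by simp
qed

lemma radial_sup_le:
  assumes r: "0 < r" and b: "0 \<le> b" and big: "\<And>t. r \<le> t \<Longrightarrow> cmod (u x t) \<le> b"
  shows "radial_sup x \<le> ennreal (b + L) + dyadic_max u x r"
  unfolding radial_sup_def
proof (rule SUP_least)
  fix t :: real assume "t \<in> {0<..}"
  then have t: "0 < t" by simp
  show "ennreal (cmod (u x t)) \<le> ennreal (b + L) + dyadic_max u x r"
  proof (cases "t \<le> r")
    case True
    have "ennreal (cmod (u x t)) \<le> ennreal (cmod (u x r)) + ennreal L + dyadic_max u x r"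
      using t True by (rule u_le_dyadic_max)
    also have "\<dots> \<le> ennreal b + ennreal L + dyadic_max u x r"
      using big[of r] by (intro add_right_mono ennreal_leI) simp
    finally show ?thesis using b L_pos by simp
  next
    case False
    then have "cmod (u x t) \<le> b + L" using big[of t] L_pos by simp
    then have "ennreal (cmod (u x t)) \<le> ennreal (b + L)" by (rule ennreal_leI)
    then show ?thesis by (rule order_trans) simp
  qed
qed

lemma radial_sup_compare:
  assumes r: "0 < r" and xy: "dist x y \<le> 2 * r" and fin: "radial_sup y < \<infinity>"
  shows "radial_sup x \<le> radial_sup y + ennreal (2 * L) + dyadic_max u x r"
proof -
  obtain b where b: "radial_sup y = ennreal b" "0 \<le> b" using fin by (cases "radial_sup y") auto
  have "radial_sup x \<le> ennreal (b + L + L) + dyadic_max u x r"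
  proof (rule radial_sup_le)
    fix t assume t: "r \<le> t"
    have "ennreal (cmod (u y t)) \<le> radial_sup y"
      unfolding radial_sup_def using r t by (intro SUP_upper) auto
    then have "cmod (u y t) \<le> b" using b by simp
    moreover have "cmod (u x t - u y t) \<le> L" using r t xy by (intro u_near) auto
    ultimately show "cmod (u x t) \<le> b + L" using norm_triangle_ineq2[of "u x t" "u y t"] by simp
  qed (use r b L_pos in auto)
  also have "ennreal (b + L + L) = radial_sup y + ennreal (2 * L)"
    using b L_pos by (simp flip: ennreal_plus)
  finally show ?thesis .
qed

lemma const_plus_dyadic_max_integral_le:
  assumes "0 < r" "0 \<le> b"
  shows "(\<integral>\<^sup>+y\<in>ball x r. (ennreal b + dyadic_max u y r) \<partial>\<mu>) \<le> ennreal ((b + osc_const * L) * V x r)"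
proof -
  note [measurable] = dyadic_max_measurable[OF assms(1)]
  have "(\<integral>\<^sup>+y\<in>ball x r. (ennreal b + dyadic_max u y r) \<partial>\<mu>)
      = (\<integral>\<^sup>+y. (ennreal b * indicator (ball x r) y + dyadic_max u y r * indicator (ball x r) y) \<partial>\<mu>)"
    by (simp add: distrib_right)
  also have "\<dots> = (\<integral>\<^sup>+y\<in>ball x r. ennreal b \<partial>\<mu>) + (\<integral>\<^sup>+y\<in>ball x r. dyadic_max u y r \<partial>\<mu>)"
    by (rule nn_integral_add) measurable
  also have "\<dots> \<le> ennreal (b * V x r) + ennreal (osc_const * L * V x r)"
    by (intro add_mono dyadic_max_integral_le assms) (simp add: nn_integral_const_ball assms)
  also have "\<dots> = ennreal ((b + osc_const * L) * V x r)"
    using assms L_pos by (simp add: osc_const_def algebra_simps flip: ennreal_plus)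
  finally show ?thesis .
qed

lemma radial_sup_integral_le:
  assumes r: "0 < r" and b: "0 \<le> b" and big: "\<And>t. r \<le> t \<Longrightarrow> cmod (u x t) \<le> b"
  shows "(\<integral>\<^sup>+y\<in>ball x r. radial_sup y \<partial>\<mu>) \<le> ennreal ((b + 2 * L + osc_const * L) * V x r)"
proof -
  have "radial_sup y \<le> ennreal (b + 2 * L) + dyadic_max u y r" if "y \<in> ball x r" for y
  proof -
    have "radial_sup y \<le> ennreal (b + L + L) + dyadic_max u y r"
    proof (rule radial_sup_le)
      fix t assume t: "r \<le> t"
      have "cmod (u y t - u x t) \<le> L"
        using that r t by (intro u_near) (auto simp: dist_commute)
      then show "cmod (u y t) \<le> b + L" using big[OF t] norm_triangle_ineq2[of "u y t" "u x t"] by simp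
    qed (use r b L_pos in auto)
    then show ?thesis by (simp only: add.assoc mult_2)
  qed
  then have "(\<integral>\<^sup>+y\<in>ball x r. radial_sup y \<partial>\<mu>) \<le> (\<integral>\<^sup>+y\<in>ball x r. (ennreal (b + 2 * L) + dyadic_max u y r) \<partial>\<mu>)"
    by (intro nn_integral_mono) (auto simp: indicator_def)
  also have "\<dots> \<le> ennreal ((b + 2 * L + osc_const * L) * V x r)"
    using r b L_pos by (intro const_plus_dyadic_max_integral_le) auto
  finally show ?thesis .
qed

text \<open>By \<open>radial_sup_compare\<close>, almost every value on the ball is at least
  \<open>S\<^sup>+f(w) - 2L - H(w)\<close>, and so is the essential infimum. Passing to real values only
  changes the maximal function on a null set, by the finiteness assumption.\<close>

lemma radial_sup_lower_oscillation:
  assumes r: "0 < r" and fin: "AE y in \<mu>. radial_sup y < \<infinity>"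
  shows "(\<integral>\<^sup>+y\<in>ball x r. e2ennreal (ereal (enn2real (radial_sup y))
              - ess_inf_ball \<mu> x r (\<lambda>y. enn2real (radial_sup y))) \<partial>\<mu>)
         \<le> ennreal ((2 * L + osc_const * L) * V x r)"
proof -
  define F where "F y = enn2real (radial_sup y)" for y
  have [measurable]: "F \<in> borel_measurable \<mu>" unfolding F_def[abs_def] by measurable
  have *: "e2ennreal (ereal (F w) - ess_inf_ball \<mu> x r F) \<le> ennreal (2 * L) + dyadic_max u w r"
    if w: "w \<in> ball x r" "radial_sup w < \<infinity>" for w
  proof (cases "dyadic_max u w r")
    case (real h)
    have "F w \<le> F y + (2 * L + h)" if "y \<in> ball x r" "radial_sup y < \<infinity>" for y
    proof -
      have "dist w y \<le> 2 * r" using that w dist_triangle3[of w y x] by simp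
      then have "radial_sup w \<le> radial_sup y + ennreal (2 * L) + ennreal h"
        using r that radial_sup_compare[of r w y] by (simp add: real)
      moreover have "radial_sup y = ennreal (F y)" "radial_sup w = ennreal (F w)"
        using that w by (auto simp: F_def)
      moreover have "0 \<le> F y" by (simp add: F_def)
      ultimately have "ennreal (F w) \<le> ennreal (F y + (2 * L + h))"
        using real L_pos by (simp add: add.assoc)
      then show ?thesis using real L_pos \<open>0 \<le> F y\<close> by (subst (asm) ennreal_le_iff) auto
    qed
    then have "AE y in restrict_space \<mu> (ball x r). - ereal (F y) \<le> ereal (2 * L + h - F w)"
      using fin by (subst AE_restrict_space_iff) (auto elim!: eventually_mono simp: algebra_simps)
    then have "esssup (restrict_space \<mu> (ball x r)) (\<lambda>y. - ereal (F y)) \<le> ereal (2 * L + h - F w)"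
      by (intro esssup_I measurable_restrict_space1) measurable
    then have "- ess_inf_ball \<mu> x r F \<le> ereal (2 * L + h - F w)"
      by (simp add: ess_inf_ball_def)
    then have "ereal (F w) - ess_inf_ball \<mu> x r F \<le> ereal (2 * L + h)"
      by (cases "ess_inf_ball \<mu> x r F") auto
    then have "e2ennreal (ereal (F w) - ess_inf_ball \<mu> x r F) \<le> e2ennreal (ereal (2 * L + h))"
      by (rule e2ennreal_mono)
    then show ?thesis using real L_pos by simp
  qed simp
  have "(\<integral>\<^sup>+y\<in>ball x r. e2ennreal (ereal (F y) - ess_inf_ball \<mu> x r F) \<partial>\<mu>)
      \<le> (\<integral>\<^sup>+y\<in>ball x r. (ennreal (2 * L) + dyadic_max u y r) \<partial>\<mu>)"
  proof (rule nn_integral_mono_AE)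
    show "AE y in \<mu>. e2ennreal (ereal (F y) - ess_inf_ball \<mu> x r F) * indicator (ball x r) y
        \<le> (ennreal (2 * L) + dyadic_max u y r) * indicator (ball x r) y"
      using fin by eventually_elim (use * in \<open>auto simp: indicator_def\<close>)
  qed
  also have "\<dots> \<le> ennreal ((2 * L + osc_const * L) * V x r)"
    using r L_pos by (intro const_plus_dyadic_max_integral_le) auto
  finally show ?thesis by (simp add: F_def[abs_def])
qed

end

section \<open>Approximations of the identity acting on BMO\<close>

locale approximate_identity = doubling_balls +
  fixes S :: "real \<Rightarrow> 'a \<Rightarrow> 'a \<Rightarrow> complex" and A \<epsilon>\<^sub>1 \<epsilon>\<^sub>2 :: real
  assumes A_pos: "0 < A" and e1_pos: "0 < \<epsilon>\<^sub>1" and e2_pos: "0 < \<epsilon>\<^sub>2"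
    and S_size: "0 < t \<Longrightarrow> cmod (S t x y) \<le> A * size_bound \<mu> \<epsilon>\<^sub>2 t x y"
    and S_hoelder: "0 < t \<Longrightarrow> dist x x' \<le> (t + dist x y) / 2 \<Longrightarrow> cmod (S t x y - S t x' y)
             \<le> A * (dist x x' / (t + dist x y)) powr \<epsilon>\<^sub>1 * size_bound \<mu> \<epsilon>\<^sub>2 t x y"
    and S_integrable: "0 < t \<Longrightarrow> integrable \<mu> (\<lambda>z. S t x z)"
    and S_one: "0 < t \<Longrightarrow> (\<integral>z. S t x z \<partial>\<mu>) = 1"
begin

definition kernel_const :: real where
  "kernel_const = D / (2 powr - \<epsilon>\<^sub>2) * tail_sum (2 powr - \<epsilon>\<^sub>2)"

lemma kernel_const_nonneg: "0 \<le> kernel_const"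
proof -
  have "2 powr - \<epsilon>\<^sub>2 < (1::real)" using e2_pos by (simp add: powr_minus_divide)
  then show ?thesis unfolding kernel_const_def tail_sum_def
    using D_ge_1 by (intro mult_nonneg_nonneg suminf_nonneg tail_sum_summable) auto
qed

lemma S_measurable [measurable]: "0 < t \<Longrightarrow> S t x \<in> borel_measurable \<mu>"
  using S_integrable by (auto dest: borel_measurable_integrable)

lemma operator_integrable:
  assumes "bounded_mean_oscillation \<mu> D f M" "0 < t"
  shows "integrable \<mu> (\<lambda>y. S t x y * f y)"
proof -
  interpret bounded_mean_oscillation \<mu> D f M by fact
  show ?thesis
    using kernel_integral_le(1)[where z = 0 and k = "S t x", OF assms(2) e2_pos refl less_imp_le[OF A_pos]
        S_measurable[OF assms(2)] S_size[OF assms(2)], of "cmod (ball_mean \<mu> x t f)"] by simp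
qed

lemma operator_near_mean:
  assumes "bounded_mean_oscillation \<mu> D f M" "0 < t"
  shows "cmod (integral_operator \<mu> (S t) f x - ball_mean \<mu> x t f) \<le> A * kernel_const * M"
proof -
  interpret bounded_mean_oscillation \<mu> D f M by fact
  show ?thesis unfolding integral_operator_def kernel_const_def
    using A_pos e2_pos assms(2)
    by (intro kernel_integral_near_mean[where k = "S t x" and \<epsilon> = \<epsilon>\<^sub>2] S_integrable S_one S_size) auto
qed

text \<open>By the Hoelder condition the difference of the kernels of \<open>x\<close> and \<open>x'\<close> satisfies the size bound
  with the small factor \<open>(d(x,x')/t)\<close> raised to the power \<open>\<epsilon>\<^sub>1\<close>.\<close>

lemma operator_continuous:
  assumes bmo: "bounded_mean_oscillation \<mu> D f M" and t: "0 < t"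
  shows "continuous_on UNIV (\<lambda>x. integral_operator \<mu> (S t) f x)"
proof (rule continuous_at_imp_continuous_on, rule ballI)
  interpret bounded_mean_oscillation \<mu> D f M by fact
  fix x
  let ?T = "integral_operator \<mu> (S t) f"
  define b where "b = cmod (ball_mean \<mu> x t f)"
  have bound: "cmod (?T x' - ?T x) \<le> A * (dist x' x / t) powr \<epsilon>\<^sub>1 * kernel_const * (M + b)"
    if x': "dist x' x \<le> t / 2" for x'
  proof -
    have "cmod (\<integral>y. (S t x y - S t x' y) * (f y - 0) \<partial>\<mu>)
        \<le> A * (dist x' x / t) powr \<epsilon>\<^sub>1 * kernel_const * (M + b)"
      unfolding kernel_const_def
    proof (rule kernel_integral_le(2)[OF t e2_pos refl])
      show "(\<lambda>y. S t x y - S t x' y) \<in> borel_measurable \<mu>" using t by measurable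
      fix y
      have sb: "0 \<le> size_bound \<mu> \<epsilon>\<^sub>2 t x y" by (simp add: size_bound_def)
      have "cmod (S t x y - S t x' y)
          \<le> A * (dist x x' / (t + dist x y)) powr \<epsilon>\<^sub>1 * size_bound \<mu> \<epsilon>\<^sub>2 t x y"
        using x' t by (intro S_hoelder) (simp_all add: dist_commute add_increasing2)
      also have "\<dots> \<le> A * (dist x' x / t) powr \<epsilon>\<^sub>1 * size_bound \<mu> \<epsilon>\<^sub>2 t x y"
        using A_pos sb e1_pos t
        by (intro mult_right_mono mult_left_mono powr_mono2 frac_le) (auto simp: dist_commute)
      finally show "cmod (S t x y - S t x' y)
          \<le> A * (dist x' x / t) powr \<epsilon>\<^sub>1 * size_bound \<mu> \<epsilon>\<^sub>2 t x y" .
    qed (use A_pos in \<open>auto simp: b_def\<close>)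
    also have "(\<integral>y. (S t x y - S t x' y) * (f y - 0) \<partial>\<mu>) = ?T x - ?T x'"
      unfolding integral_operator_def using operator_integrable[OF bmo t]
      by (subst Bochner_Integration.integral_diff[symmetric]) (auto simp: algebra_simps)
    finally show ?thesis by (simp add: norm_minus_commute)
  qed
  have "((\<lambda>x'. (dist x' x / t) powr \<epsilon>\<^sub>1) \<longlongrightarrow> 0) (at x)"
    using e1_pos t by (intro tendsto_zero_powrI[where b = \<epsilon>\<^sub>1] tendsto_eq_intros) auto
  then have "((\<lambda>x'. A * (dist x' x / t) powr \<epsilon>\<^sub>1 * kernel_const * (M + b)) \<longlongrightarrow> 0) (at x)"
    by (intro tendsto_mult_left_zero tendsto_mult_right_zero)
  moreover have "\<forall>\<^sub>F x' in at x. cmod (?T x' - ?T x) \<le> A * (dist x' x / t) powr \<epsilon>\<^sub>1 * kernel_const * (M + b)"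
    unfolding eventually_at using t bound by (intro exI[of _ "t / 2"]) auto
  ultimately have "((\<lambda>x'. ?T x' - ?T x) \<longlongrightarrow> 0) (at x)" by (rule Lim_null_comparison[rotated])
  then show "isCont ?T x" by (simp add: isCont_def LIM_zero_iff)
qed

text \<open>Two errors \<open>|S\<^sub>t f - a|\<close>, plus the distance of two comparable means, plus one for the oscillation
  of \<open>f\<close> itself.\<close>

definition family_const :: real where
  "family_const = 2 * (A * kernel_const) + 2 * D ^ 4 + 1"

lemma operator_averaging_family:
  assumes bmo: "bounded_mean_oscillation \<mu> D f M" and M: "0 < M"
  shows "averaging_family \<mu> D f (\<lambda>x t. integral_operator \<mu> (S t) f x) (family_const * M)"
proof -
  interpret bounded_mean_oscillation \<mu> D f M by fact
  let ?K = "A * kernel_const * M"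
  have K: "0 \<le> ?K" using A_pos kernel_const_nonneg M by simp
  have DM: "0 \<le> D ^ 4 * M" using D_ge_1 M by simp
  show ?thesis
  proof unfold_locales
    show "0 < family_const * M"
      unfolding family_const_def using A_pos kernel_const_nonneg D_ge_1 M
      by (intro mult_pos_pos add_nonneg_pos add_nonneg_nonneg) auto
    show "f \<in> borel_measurable \<mu>" by measurable
    fix s :: real assume s: "0 < s"
    show "continuous_on UNIV (\<lambda>x. integral_operator \<mu> (S s) f x)"
      using bmo s by (rule operator_continuous)
    fix x
    have "(\<integral>\<^sup>+y\<in>ball x s. ennreal (cmod (f y - integral_operator \<mu> (S s) f x)) \<partial>\<mu>)
        \<le> ennreal ((M + ?K) * V x s)"
      using s M_nonneg K osc[OF s] operator_near_mean[OF bmo s, of x]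
      by (intro recentre[where w = "ball_mean \<mu> x s f"]) (auto simp: norm_minus_commute)
    also have "\<dots> \<le> ennreal (family_const * M * V x s)"
    proof (intro ennreal_leI mult_right_mono)
      have "family_const * M = ?K + ?K + 2 * (D ^ 4 * M) + M"
        by (simp add: family_const_def algebra_simps)
      then show "M + ?K \<le> family_const * M" using K DM by linarith
    qed simp
    finally show "(\<integral>\<^sup>+y\<in>ball x s. ennreal (cmod (f y - integral_operator \<mu> (S s) f x)) \<partial>\<mu>)
        \<le> ennreal (family_const * M * V x s)" .
  next
    fix r s :: real and x y :: 'a
    assume rs: "0 < r" "dist x y \<le> 2 * r" "r \<le> s" "s \<le> 2 * r"
    have "cmod (integral_operator \<mu> (S r) f x - ball_mean \<mu> x r f) \<le> ?K"
      "cmod (integral_operator \<mu> (S s) f y - ball_mean \<mu> y s f) \<le> ?K"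
      using rs by (auto intro!: operator_near_mean[OF bmo])
    moreover have "cmod (ball_mean \<mu> x r f - ball_mean \<mu> y s f) \<le> 2 * D ^ 4 * M"
      using rs by (rule mean_near)
    moreover have "cmod (integral_operator \<mu> (S r) f x - integral_operator \<mu> (S s) f y)
        \<le> cmod (integral_operator \<mu> (S r) f x - ball_mean \<mu> x r f)
          + cmod (ball_mean \<mu> x r f - ball_mean \<mu> y s f)
          + cmod (integral_operator \<mu> (S s) f y - ball_mean \<mu> y s f)"
      by norm
    ultimately show "cmod (integral_operator \<mu> (S r) f x - integral_operator \<mu> (S s) f y)
        \<le> family_const * M"
      using M by (simp add: family_const_def distrib_right)
  qed
qed

text \<open>On large balls the norm bounds the mean of \<open>|f|\<close>, hence the oscillation by twice as much.\<close>

lemma BMO_bounded_mean_oscillation: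
  assumes f: "f \<in> L1_loc \<mu>" and N: "0 \<le> N" "BMO_norm \<mu> \<rho> f \<le> ennreal N"
  shows "bounded_mean_oscillation \<mu> D f (2 * N)"
    and "0 < r \<Longrightarrow> \<rho> x \<le> r \<Longrightarrow> cmod (ball_mean \<mu> x r f) \<le> N"
proof -
  have large: "(\<integral>\<^sup>+y\<in>ball x r. ennreal (cmod (f y)) \<partial>\<mu>) \<le> ennreal (N * V x r)"
    if "0 < r" "\<rho> x \<le> r" for x r
  proof -
    have "ball_mean_nn \<mu> x r (\<lambda>y. ennreal (cmod (f y)))
        \<le> (SUP (x, r)\<in>large_balls \<rho>. ball_mean_nn \<mu> x r (\<lambda>y. ennreal (cmod (f y))))"
      using that by (intro SUP_upper2[of "(x, r)"]) (auto simp: large_balls_def)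
    also have "\<dots> \<le> BMO_norm \<mu> \<rho> f" by (simp add: BMO_norm_def)
    also note N(2)
    finally show ?thesis using that N by (simp add: ball_mean_nn_le_iff)
  qed
  show mean: "cmod (ball_mean \<mu> x r f) \<le> N" if "0 < r" "\<rho> x \<le> r" for x r
  proof -
    have "cmod (ball_mean \<mu> x r f - 0) * V x r \<le> N * V x r"
      using large[OF that] N f that by (intro mean_deviation) auto
    then show ?thesis using V_pos[OF that(1), of x] by simp
  qed
  show "bounded_mean_oscillation \<mu> D f (2 * N)"
  proof unfold_locales
    fix r :: real and x assume r: "0 < r"
    show "(\<integral>\<^sup>+y\<in>ball x r. ennreal (cmod (f y - ball_mean \<mu> x r f)) \<partial>\<mu>) \<le> ennreal (2 * N * V x r)"
    proof (cases "\<rho> x \<le> r")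
      case True
      then have "(\<integral>\<^sup>+y\<in>ball x r. ennreal (cmod (f y - ball_mean \<mu> x r f)) \<partial>\<mu>) \<le> ennreal ((N + N) * V x r)"
        using large[of r x] mean[of r x] r N L1_loc_measurable[OF f]
        by (intro recentre[where w = 0]) auto
      then show ?thesis by simp
    next
      case False
      have "ball_mean_nn \<mu> x r (\<lambda>y. ennreal (cmod (f y - ball_mean \<mu> x r f)))
        \<le> (SUP (x, r)\<in>small_balls \<rho>. ball_mean_nn \<mu> x r (\<lambda>y. ennreal (cmod (f y - ball_mean \<mu> x r f))))"
        using False r by (intro SUP_upper2[of "(x, r)"]) (auto simp: small_balls_def large_balls_def)
      also have "\<dots> \<le> BMO_norm \<mu> \<rho> f" by (simp add: BMO_norm_def)
      also note N(2)
      finally have "(\<integral>\<^sup>+y\<in>ball x r. ennreal (cmod (f y - ball_mean \<mu> x r f)) \<partial>\<mu>) \<le> ennreal (N * V x r)"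
        using r N by (simp add: ball_mean_nn_le_iff)
      also have "\<dots> \<le> ennreal (2 * N * V x r)" using N by (intro ennreal_leI mult_right_mono) auto
      finally show ?thesis .
    qed
  qed (use f N in auto)
qed

definition BLO_const :: real where
  "BLO_const = 1 + 2 * (A * kernel_const) + 2 * ((4 + 2 * osc_const) * family_const)"

lemma family_const_nonneg: "0 \<le> family_const"
  using A_pos kernel_const_nonneg D_ge_1 by (simp add: family_const_def)

lemma BLO_const_pos: "0 < BLO_const"
  using A_pos kernel_const_nonneg family_const_nonneg
  by (simp add: osc_const_def BLO_const_def add_pos_nonneg)

text \<open>The bound \<open>N\<close> is required to be positive because the stopping argument needs a positive
  threshold; a vanishing norm is reached by letting \<open>N\<close> tend to zero.\<close>

lemma radial_maximal_BLO:
  assumes f: "f \<in> L1_loc \<mu>" and N: "0 < N" "BMO_norm \<mu> \<rho> f \<le> ennreal N"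
  shows "AE x in \<mu>. radial_maximal \<mu> S f x < \<infinity>"
    and "(\<lambda>x. enn2real (radial_maximal \<mu> S f x)) \<in> L1_loc \<mu>"
    and "BLO_norm \<mu> \<rho> (\<lambda>x. enn2real (radial_maximal \<mu> S f x)) \<le> ennreal (BLO_const * N)"
proof -
  have bmo: "bounded_mean_oscillation \<mu> D f (2 * N)"
    using f N by (intro BMO_bounded_mean_oscillation(1)) auto
  define L where "L = family_const * (2 * N)"
  interpret averaging_family \<mu> D f "\<lambda>x t. integral_operator \<mu> (S t) f x" L
    unfolding L_def using bmo N by (intro operator_averaging_family) auto
  have eq: "radial_maximal \<mu> S f = radial_sup"
    by (simp add: fun_eq_iff radial_maximal_def radial_sup_def)
  define b where "b = N + A * kernel_const * (2 * N)"
  have b: "0 \<le> b" using N A_pos kernel_const_nonneg by (simp add: b_def)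
  have oc: "0 \<le> osc_const" by (simp add: osc_const_def)
  have large: "(\<integral>\<^sup>+y\<in>ball x r. radial_sup y \<partial>\<mu>) \<le> ennreal ((b + 2 * L + osc_const * L) * V x r)"
    if r: "0 < r" "\<rho> x \<le> r" for x r
  proof (rule radial_sup_integral_le[OF r(1) b])
    fix t assume t: "r \<le> t"
    have "cmod (ball_mean \<mu> x t f) \<le> N"
      using f N r t by (intro BMO_bounded_mean_oscillation(2)[where \<rho> = \<rho>]) auto
    moreover have "cmod (integral_operator \<mu> (S t) f x - ball_mean \<mu> x t f) \<le> A * kernel_const * (2 * N)"
      using bmo r t by (intro operator_near_mean) auto
    ultimately show "cmod (integral_operator \<mu> (S t) f x) \<le> b"
      using norm_triangle_ineq2[of "integral_operator \<mu> (S t) f x" "ball_mean \<mu> x t f"]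
      by (simp add: b_def)
  qed
  have finite_ball: "(\<integral>\<^sup>+y\<in>ball x r. radial_sup y \<partial>\<mu>) < \<infinity>" if "0 < r" for x r
  proof -
    have "(\<integral>\<^sup>+y\<in>ball x r. radial_sup y \<partial>\<mu>) \<le> (\<integral>\<^sup>+y\<in>ball x (max r (\<rho> x)). radial_sup y \<partial>\<mu>)"
      by (intro nn_integral_mono) (auto simp: indicator_def)
    also have "\<dots> \<le> ennreal ((b + 2 * L + osc_const * L) * V x (max r (\<rho> x)))"
      using that by (intro large) auto
    also have "\<dots> < \<infinity>" by simp
    finally show ?thesis .
  qed
  have fin: "AE y in \<mu>. radial_sup y < \<infinity>"
  proof -
    have "AE y in \<mu>. radial_sup y * indicator (ball undefined (real (Suc n))) y \<noteq> \<infinity>" for n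
      using finite_ball[of "real (Suc n)" undefined] by (intro nn_integral_noteq_infinite) auto
    then have "AE y in \<mu>. \<forall>n. radial_sup y * indicator (ball undefined (real (Suc n))) y \<noteq> \<infinity>"
      by (simp add: AE_all_countable)
    then show ?thesis
    proof eventually_elim
      case (elim y)
      obtain n :: nat where "dist undefined y < real n" using reals_Archimedean2 by blast
      then show ?case using elim[rule_format, of n] by (auto simp: less_top)
    qed
  qed
  then show "AE x in \<mu>. radial_maximal \<mu> S f x < \<infinity>" by (simp add: eq)
  have nn_le: "(\<integral>\<^sup>+y\<in>ball x r. ennreal \<bar>enn2real (radial_sup y)\<bar> \<partial>\<mu>) \<le> (\<integral>\<^sup>+y\<in>ball x r. radial_sup y \<partial>\<mu>)" for x r
    by (intro nn_integral_mono mult_right_mono) (auto simp: ennreal_enn2real_if)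
  show "(\<lambda>x. enn2real (radial_maximal \<mu> S f x)) \<in> L1_loc \<mu>"
    unfolding eq L1_loc_def set_integrable_def
  proof (intro CollectI allI impI integrableI_bounded)
    fix x and r :: real assume "0 < r"
    have "(\<integral>\<^sup>+y. ennreal (norm (indicator (ball x r) y *\<^sub>R enn2real (radial_sup y))) \<partial>\<mu>)
        = (\<integral>\<^sup>+y\<in>ball x r. ennreal \<bar>enn2real (radial_sup y)\<bar> \<partial>\<mu>)"
      by (intro nn_integral_cong) (auto simp: indicator_def)
    also note nn_le
    also note finite_ball[OF \<open>0 < r\<close>]
    finally show "(\<integral>\<^sup>+y. ennreal (norm (indicator (ball x r) y *\<^sub>R enn2real (radial_sup y))) \<partial>\<mu>) < \<infinity>" .
  qed measurable
  show "BLO_norm \<mu> \<rho> (\<lambda>x. enn2real (radial_maximal \<mu> S f x)) \<le> ennreal (BLO_const * N)"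
  proof -
    have "BLO_norm \<mu> \<rho> (\<lambda>x. enn2real (radial_sup x))
        \<le> ennreal (2 * L + osc_const * L) + ennreal (b + 2 * L + osc_const * L)"
      unfolding BLO_norm_def
    proof (intro add_mono SUP_least; clarify)
      fix x r assume "(x, r) \<in> small_balls \<rho>"
      then have r: "0 < r" by (simp add: small_balls_def)
      then show "ball_mean_nn \<mu> x r (\<lambda>y. e2ennreal (ereal (enn2real (radial_sup y))
            - ess_inf_ball \<mu> x r (\<lambda>y. enn2real (radial_sup y)))) \<le> ennreal (2 * L + osc_const * L)"
        using radial_sup_lower_oscillation[OF r fin] L_pos oc by (subst ball_mean_nn_le_iff) auto
    next
      fix x r assume "(x, r) \<in> large_balls \<rho>"
      then have r: "0 < r" "\<rho> x \<le> r" by (auto simp: large_balls_def)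
      show "ball_mean_nn \<mu> x r (\<lambda>y. ennreal \<bar>enn2real (radial_sup y)\<bar>) \<le> ennreal (b + 2 * L + osc_const * L)"
        using order_trans[OF nn_le large[OF r]] r L_pos oc b by (subst ball_mean_nn_le_iff) auto
    qed
    also have "\<dots> = ennreal (BLO_const * N)"
    proof -
      have "(2 * L + osc_const * L) + (b + 2 * L + osc_const * L) = BLO_const * N"
        by (simp add: BLO_const_def b_def L_def osc_const_def algebra_simps)
      then show ?thesis using L_pos oc b by (simp flip: ennreal_plus)
    qed
    finally show ?thesis by (simp add: eq)
  qed
qed

end

theorem theorem5p1:
  fixes \<mu> :: "'a::metric_space measure"
    and \<rho> :: "'a \<Rightarrow> real"
    and S :: "real \<Rightarrow> 'a \<Rightarrow> 'a \<Rightarrow> complex"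
    and \<epsilon>\<^sub>1 \<epsilon>\<^sub>2 :: real
  assumes "RD_space \<mu>"
    and "admissible \<rho>"
    and "0 < \<epsilon>\<^sub>1" and "\<epsilon>\<^sub>1 \<le> 1" and "0 < \<epsilon>\<^sub>2"
    and "continuous_approximation_of_identity \<mu> \<epsilon>\<^sub>1 \<epsilon>\<^sub>2 S"
  shows "\<exists>C::real. C > 0 \<and>
    (\<forall>f\<in>BMO \<mu> \<rho>.
       (\<forall>t>0. \<forall>x. integrable \<mu> (\<lambda>y. S t x y * f y)) \<and>
       (AE x in \<mu>. radial_maximal \<mu> S f x < \<infinity>) \<and>
       (\<lambda>x. enn2real (radial_maximal \<mu> S f x)) \<in> BLO \<mu> \<rho> \<and>
       BLO_norm \<mu> \<rho> (\<lambda>x. enn2real (radial_maximal \<mu> S f x)) \<le> ennreal C * BMO_norm \<mu> \<rho> f)"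
proof -
  obtain D where D: "1 \<le> D"
      "\<And>x r. 0 < r \<Longrightarrow> measure \<mu> (ball x (2 * r)) \<le> D * measure \<mu> (ball x r)"
    using assms(1) unfolding RD_space_def doubling_def by blast
  obtain A where A: "0 < A"
    and S: "\<forall>t>0.
        (\<forall>x y. cmod (S t x y) \<le> A * size_bound \<mu> \<epsilon>\<^sub>2 t x y) \<and>
        (\<forall>x x' y. dist x x' \<le> (t + dist x y) / 2 \<longrightarrow>
           cmod (S t x y - S t x' y)
             \<le> A * (dist x x' / (t + dist x y)) powr \<epsilon>\<^sub>1 * size_bound \<mu> \<epsilon>\<^sub>2 t x y) \<and>
        (\<forall>x y y'. dist y y' \<le> (t + dist x y) / 2 \<longrightarrow>
           cmod (S t x y - S t x y')
             \<le> A * (dist y y' / (t + dist x y)) powr \<epsilon>\<^sub>1 * size_bound \<mu> \<epsilon>\<^sub>2 t x y)"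
    using assms(6) unfolding continuous_approximation_of_identity_def by (elim conjE exE) (rule that)
  interpret approximate_identity \<mu> D S A \<epsilon>\<^sub>1 \<epsilon>\<^sub>2
  proof unfold_locales
    show "sets borel \<subseteq> sets \<mu>"
      using assms(1) by (simp add: RD_space_def regular_borel_measure_def)
    show "0 < emeasure \<mu> (ball x r)" "emeasure \<mu> (ball x r) < \<infinity>" if "0 < r" for x r
      using assms(1) that by (auto simp: RD_space_def)
    show "integrable \<mu> (\<lambda>z. S t x z)" "(\<integral>z. S t x z \<partial>\<mu>) = 1" if "0 < t" for t x
      using assms(6) that by (auto simp: continuous_approximation_of_identity_def)
  qed (use assms(3,5) D A S in simp_all)
  show ?thesis
  proof (intro exI[of _ BLO_const] conjI ballI BLO_const_pos)
    fix f assume "f \<in> BMO \<mu> \<rho>"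
    then have f: "f \<in> L1_loc \<mu>" and fin: "BMO_norm \<mu> \<rho> f < \<infinity>" by (auto simp: BMO_def)
    obtain N where N: "BMO_norm \<mu> \<rho> f = ennreal N" "0 \<le> N"
      using fin by (cases "BMO_norm \<mu> \<rho> f") auto
    show "\<forall>t>0. \<forall>x. integrable \<mu> (\<lambda>y. S t x y * f y)"
      using BMO_bounded_mean_oscillation(1)[OF f N(2), of \<rho>] N(1) by (auto intro: operator_integrable)
    have N1: "0 < N + e" "BMO_norm \<mu> \<rho> f \<le> ennreal (N + e)" if "0 < e" for e
      using N that by (auto intro: ennreal_leI)
    note * = radial_maximal_BLO[OF f N1[OF zero_less_one]]
    show "AE x in \<mu>. radial_maximal \<mu> S f x < \<infinity>" using * by simp
    have "BLO_norm \<mu> \<rho> (\<lambda>x. enn2real (radial_maximal \<mu> S f x)) < \<infinity>"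
      using *(3) by (auto intro: le_less_trans)
    then show "(\<lambda>x. enn2real (radial_maximal \<mu> S f x)) \<in> BLO \<mu> \<rho>"
      using *(2) by (simp add: BLO_def)
    have "BLO_norm \<mu> \<rho> (\<lambda>x. enn2real (radial_maximal \<mu> S f x)) \<le> ennreal (BLO_const * N)"
    proof (rule ennreal_le_epsilon)
      fix e :: real assume "0 < e"
      then have e: "0 < e / BLO_const" using BLO_const_pos by simp
      have "BLO_norm \<mu> \<rho> (\<lambda>x. enn2real (radial_maximal \<mu> S f x))
          \<le> ennreal (BLO_const * (N + e / BLO_const))"
        using N1[OF e] by (intro radial_maximal_BLO(3)[OF f])
      also have "BLO_const * (N + e / BLO_const) = BLO_const * N + e"
        using BLO_const_pos by (simp add: field_simps)
      also have "ennreal (BLO_const * N + e) = ennreal (BLO_const * N) + ennreal e"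
        using BLO_const_pos N(2) \<open>0 < e\<close> by simp
      finally show "BLO_norm \<mu> \<rho> (\<lambda>x. enn2real (radial_maximal \<mu> S f x))
          \<le> ennreal (BLO_const * N) + ennreal e" .
    qed
    then show "BLO_norm \<mu> \<rho> (\<lambda>x. enn2real (radial_maximal \<mu> S f x))
        \<le> ennreal BLO_const * BMO_norm \<mu> \<rho> f"
      using BLO_const_pos N by (simp add: ennreal_mult)
  qed
qed

end
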